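(* Let $\mathcal{B}$ be a body in three-dimensional Euclidean space made of a homogeneous compressible isotropic Cauchy elastic solid with residual stress. Then the set of universal deformations consists precisely of all homogeneous deformations, and there are no non-trivial universal residual stresses. That is: (i) a deformation $\varphi:\mathcal{B}\to\mathcal{C}$ is universal (i.e. there is a residual stress field $\mathring{\mathbf{S}}$ on $\mathcal{B}$ such that $(\varphi,\mathring{\mathbf{S}})$ is a universal pair) if and only if $\varphi$ is homogeneous; (ii) if $(\varphi,\mathring{\mathbf{S}})$ is a universal pair, then $\mathring{\mathbf{S}}=\mathbf{0}$ on $\mathcal{B}$.
   Context: Ambient space: three-dimensional Euclidean space $\mathcal{S}$ with flat metric $\mathbf{g}$. The body $\mathcal{B}\subset\mathcal{S}$ is a bounded connected three-dimensional region with smooth boundary $\partial\mathcal{B}$ and outward unit normal $\mathbf{N}$, carrying the induced flat metric $\mathbf{G}=\mathbf{g}|_{\mathcal{B}}$. All fields are smooth. Use Cartesian coordinates $X^A$ on $\mathcal{B}$ and $x^a$ on $\mathcal{S}$, so that $G_{AB}=\delta_{AB}$, $g_{ab}=\delta_{ab}$. Deformation: a smooth map $\varphi:\mathcal{B}\to\mathcal{C}=\varphi(\mathcal{B})\subset\mathcal{S}$ that is a diffeomorphism onto its image, with deformation gradient $\mathbf{F}$, $F^a{}_A=\partial\varphi^a/\partial X^A$. It is homogeneous if $F^a{}_A$ (Cartesian components) is constant on $\mathcal{B}$. Strain: $\mathbf{b}=\mathbf{F}\mathbf{F}^{\mathsf T}$, i.e. $b^{ab}=F^a{}_AF^b{}_BG^{AB}$,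 and $\mathbf{c}=\mathbf{b}^{-1}$, regarded as symmetric tensor fields on $\mathcal{C}$. Residual stress: a symmetric second-order tensor field $\mathring{\mathbf{S}}$ on $\mathcal{B}$ (second Piola–Kirchhoff residual stress) with $\operatorname{Div}\mathring{\mathbf{S}}=\mathbf{0}$ in $\mathcal{B}$ and $\mathring{\mathbf{S}}\mathbf{N}=\mathbf{0}$ on $\partial\mathcal{B}$, where $\operatorname{Div}$ is the divergence with respect to $\mathbf{G}$. No assumption is made about its source. Non-trivial means not identically zero. Its push-forward is $\mathring{\boldsymbol{\sigma}}=\mathbf{F}\mathring{\mathbf{S}}\mathbf{F}^{\star}$, i.e. $\mathring{\sigma}^{ab}=F^a{}_AF^b{}_B\mathring{S}^{AB}$, a tensor field on $\mathcal{C}$. Material class: a homogeneous compressible isotropic Cauchy elastic solid with residual stress has Cauchy stress on $\mathcal{C}$ $$\boldsymbol{\sigma}=\alpha_0\mathbf{g}^\sharp+\alpha_1\mathbf{b}+\alpha_2\mathbf{c}+\alpha_3\mathring{\boldsymbol{\sigma}}+\alpha_4\mathring{\boldsymbol{\sigma}}^2+\alpha_5(\mathbf{b}\mathring{\boldsymbol{\sigma}}+\mathring{\boldsymbol{\sigma}}\mathbf{b})+\alpha_6(\mathbf{c}\mathring{\boldsymbol{\sigma}}+\mathring{\boldsymbol{\sigma}}\mathbf{c})+\alpha_7(\mathbf{b}\mathring{\boldsymbol{\sigma}}^2+\mathring{\boldsymbol{\sigma}}^2\mathbf{b}),$$ where $\mathbf{g}^\sharp$ is the inverse metric (the identity in Cartesian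 coordinates), products are matrix products in Cartesian components, and $\alpha_i=\alpha_i(I_1,\dots,I_{10})$, $i=0,\dots,7$, are smooth scalar response functions (with no explicit dependence on position) of $I_1=\operatorname{tr}\mathbf{b}$, $I_2=\tfrac12(I_1^2-\operatorname{tr}\mathbf{b}^2)$, $I_3=\det\mathbf{b}$, $I_4=\operatorname{tr}\mathring{\boldsymbol{\sigma}}$, $I_5=\operatorname{tr}\mathring{\boldsymbol{\sigma}}^2$, $I_6=\operatorname{tr}\mathring{\boldsymbol{\sigma}}^3$, $I_7=\operatorname{tr}(\mathbf{b}\mathring{\boldsymbol{\sigma}})$, $I_8=\operatorname{tr}(\mathbf{b}^2\mathring{\boldsymbol{\sigma}})$, $I_9=\operatorname{tr}(\mathbf{b}\mathring{\boldsymbol{\sigma}}^2)$, $I_{10}=\operatorname{tr}(\mathbf{b}^2\mathring{\boldsymbol{\sigma}}^2)$. Universality: a pair $(\varphi,\mathring{\mathbf{S}})$ of a deformation and a residual stress field is universal if the equilibrium equations without body forces, $\operatorname{div}\boldsymbol{\sigma}=\mathbf{0}$ in $\mathcal{C}$ (divergence with respect to $\mathbf{g}$), hold for every choice of the smooth response functions $\alpha_0,\dots,\alpha_7$. A deformation $\varphi$ is universal if it belongs to some universal pair, and a residual stress field is universal if it belongs to some universal pair. *)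

theory Defs
  imports "HOL-Analysis.Analysis"
begin

section \<open>Smooth maps\<close>

text \<open>Differentiability class \<open>C\<^sup>n\<close>, meant for an open set: continuity of all iterated
  directional derivatives up to order \<open>n\<close>.\<close>

fun Cn_on :: "nat \<Rightarrow> 'a::real_normed_vector set \<Rightarrow> ('a \<Rightarrow> 'b::real_normed_vector) \<Rightarrow> bool" where
  "Cn_on 0 U f \<longleftrightarrow> continuous_on U f"
| "Cn_on (Suc n) U f \<longleftrightarrow>
     (\<forall>x\<in>U. f differentiable (at x)) \<and>
     (\<forall>v. Cn_on n U (\<lambda>x. frechet_derivative f (at x) v))"

text \<open>Smoothness on an arbitrary set in the usual sense of differential topology: locally the
  restriction of a \<open>C\<^sup>\<infinity>\<close> map defined on an open set. On a closed region this is smoothness up to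
  the boundary; on an open set it is ordinary smoothness.\<close>

definition smooth_on :: "'a::real_normed_vector set \<Rightarrow> ('a \<Rightarrow> 'b::real_normed_vector) \<Rightarrow> bool" where
  "smooth_on A f \<longleftrightarrow>
     (\<forall>x\<in>A. \<exists>U g. open U \<and> x \<in> U \<and> (\<forall>n. Cn_on n U g) \<and> (\<forall>y\<in>U \<inter> A. g y = f y))"


section \<open>Bodies\<close>

definition local_defining_function ::
    "(real^3) set \<Rightarrow> real^3 \<Rightarrow> (real^3) set \<Rightarrow> (real^3 \<Rightarrow> real) \<Rightarrow> bool" where
  "local_defining_function B p U \<rho> \<longleftrightarrow>
     open U \<and> p \<in> U \<and> smooth_on U \<rho> \<and>
     (\<forall>x\<in>U. \<exists>g. g \<noteq> 0 \<and> GDERIV \<rho> x :> g) \<and>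
     B \<inter> U = {x\<in>U. \<rho> x \<le> 0}"

text \<open>A body includes its boundary. The regularity of the boundary forces the body to be
  three-dimensional, i.e. the closure of its interior.\<close>

definition body :: "(real^3) set \<Rightarrow> bool" where
  "body B \<longleftrightarrow>
     B \<noteq> {} \<and> bounded B \<and> closed B \<and> connected B \<and>
     (\<forall>p\<in>frontier B. \<exists>U \<rho>. local_defining_function B p U \<rho>)"

definition outward_unit_normal :: "(real^3) set \<Rightarrow> real^3 \<Rightarrow> real^3 \<Rightarrow> bool" where
  "outward_unit_normal B p N \<longleftrightarrow>
     (\<exists>U \<rho> g. local_defining_function B p U \<rho> \<and> GDERIV \<rho> p :> g \<and> N = g /\<^sub>R norm g)"


section \<open>Kinematics\<close>

definition deformation :: "(real^3) set \<Rightarrow> (real^3 \<Rightarrow> real^3) \<Rightarrow> bool" where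
  "deformation B \<phi> \<longleftrightarrow>
     smooth_on B \<phi> \<and> inj_on \<phi> B \<and> smooth_on (\<phi> ` B) (inv_into B \<phi>)"

text \<open>Row index \<open>a\<close>, column index \<open>A\<close>. On a body, the derivative relative to \<open>B\<close> is uniquely
  determined also at boundary points.\<close>

definition deformation_gradient ::
    "(real^3) set \<Rightarrow> (real^3 \<Rightarrow> real^3) \<Rightarrow> real^3 \<Rightarrow> real^3^3" where
  "deformation_gradient B \<phi> X = jacobian \<phi> (at X within B)"

definition homogeneous_deformation :: "(real^3) set \<Rightarrow> (real^3 \<Rightarrow> real^3) \<Rightarrow> bool" where
  "homogeneous_deformation B \<phi> \<longleftrightarrow>
     deformation B \<phi> \<and> (\<exists>A. \<forall>X\<in>B. deformation_gradient B \<phi> X = A)"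

text \<open>Spatial fields are evaluated at points \<open>x\<close> of the deformed body \<open>\<phi> ` B\<close>.\<close>

definition b_field :: "(real^3) set \<Rightarrow> (real^3 \<Rightarrow> real^3) \<Rightarrow> real^3 \<Rightarrow> real^3^3" where
  "b_field B \<phi> x =
     (let F = deformation_gradient B \<phi> (inv_into B \<phi> x) in F ** transpose F)"


section \<open>Residual stress\<close>

text \<open>\<open>v\<^sup>a = \<partial>T\<^sup>a\<^sup>b / \<partial>x\<^sup>b\<close>, with derivatives taken relative to the region \<open>R\<close>.\<close>

definition has_divergence ::
    "(real^3 \<Rightarrow> real^3^3) \<Rightarrow> real^3 \<Rightarrow> real^3 \<Rightarrow> (real^3) set \<Rightarrow> bool" where
  "has_divergence T v x R \<longleftrightarrow>
     (\<exists>T'. (T has_derivative T') (at x within R) \<and>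
           v = (\<chi> a. \<Sum>b\<in>UNIV. T' (axis b 1) $ a $ b))"

definition residual_stress :: "(real^3) set \<Rightarrow> (real^3 \<Rightarrow> real^3^3) \<Rightarrow> bool" where
  "residual_stress B S \<longleftrightarrow>
     smooth_on B S \<and>
     (\<forall>X\<in>B. transpose (S X) = S X) \<and>
     (\<forall>X\<in>B. has_divergence S 0 X B) \<and>
     (\<forall>X\<in>frontier B. \<forall>N. outward_unit_normal B X N \<longrightarrow> S X *v N = 0)"

definition pushed_residual_stress ::
    "(real^3) set \<Rightarrow> (real^3 \<Rightarrow> real^3) \<Rightarrow> (real^3 \<Rightarrow> real^3^3) \<Rightarrow> real^3 \<Rightarrow> real^3^3" where
  "pushed_residual_stress B \<phi> S x =
     (let X = inv_into B \<phi> x; F = deformation_gradient B \<phi> X in F ** S X ** transpose F)"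


section \<open>Constitutive class and universality\<close>

type_synonym real10 =
  "real \<times> real \<times> real \<times> real \<times> real \<times> real \<times> real \<times> real \<times> real \<times> real"

text \<open>The tuple \<open>(I\<^sub>1, \<dots>, I\<^sub>1\<^sub>0)\<close> as a function of \<open>b\<close> and the pushed-forward residual stress \<open>s\<close>.\<close>

definition invariants :: "real^3^3 \<Rightarrow> real^3^3 \<Rightarrow> real10" where
  "invariants b s =
     (trace b,
      ((trace b)\<^sup>2 - trace (b ** b)) / 2,
      det b,
      trace s,
      trace (s ** s),
      trace (s ** s ** s),
      trace (b ** s),
      trace (b ** b ** s),
      trace (b ** (s ** s)),
      trace (b ** b ** (s ** s)))"

text \<open>The natural domain of the response functions, so that e.g. negative powers of \<open>I\<^sub>3\<close> are
  admissible.\<close>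

definition attainable_invariants :: "real10 set" where
  "attainable_invariants =
     {invariants (F ** transpose F) s |(F :: real^3^3) s. invertible F \<and> transpose s = s}"

definition response_functions :: "(nat \<Rightarrow> real10 \<Rightarrow> real) \<Rightarrow> bool" where
  "response_functions \<alpha> \<longleftrightarrow> (\<forall>i\<le>7. smooth_on attainable_invariants (\<alpha> i))"

definition stress_response ::
    "(nat \<Rightarrow> real10 \<Rightarrow> real) \<Rightarrow> real^3^3 \<Rightarrow> real^3^3 \<Rightarrow> real^3^3" where
  "stress_response \<alpha> b s =
     (let I = invariants b s; c = matrix_inv b; s2 = s ** s in
        \<alpha> 0 I *\<^sub>R mat 1 + \<alpha> 1 I *\<^sub>R b + \<alpha> 2 I *\<^sub>R c
      + \<alpha> 3 I *\<^sub>R s + \<alpha> 4 I *\<^sub>R s2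
      + \<alpha> 5 I *\<^sub>R (b ** s + s ** b)
      + \<alpha> 6 I *\<^sub>R (c ** s + s ** c)
      + \<alpha> 7 I *\<^sub>R (b ** s2 + s2 ** b))"

definition cauchy_stress ::
    "(nat \<Rightarrow> real10 \<Rightarrow> real) \<Rightarrow> (real^3) set \<Rightarrow> (real^3 \<Rightarrow> real^3) \<Rightarrow> (real^3 \<Rightarrow> real^3^3)
      \<Rightarrow> real^3 \<Rightarrow> real^3^3" where
  "cauchy_stress \<alpha> B \<phi> S x =
     stress_response \<alpha> (b_field B \<phi> x) (pushed_residual_stress B \<phi> S x)"

definition universal_pair ::
    "(real^3) set \<Rightarrow> (real^3 \<Rightarrow> real^3) \<Rightarrow> (real^3 \<Rightarrow> real^3^3) \<Rightarrow> bool" where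
  "universal_pair B \<phi> S \<longleftrightarrow>
     deformation B \<phi> \<and> residual_stress B S \<and>
     (\<forall>\<alpha>. response_functions \<alpha> \<longrightarrow>
        (\<forall>x\<in>\<phi> ` B. has_divergence (cauchy_stress \<alpha> B \<phi> S) 0 x (\<phi> ` B)))"

definition universal_deformation :: "(real^3) set \<Rightarrow> (real^3 \<Rightarrow> real^3) \<Rightarrow> bool" where
  "universal_deformation B \<phi> \<longleftrightarrow> (\<exists>S. universal_pair B \<phi> S)"

end

theory Submission
  imports Defs
begin

text \<open>Taking a single nonzero response function, equal to a coordinate of the invariants or to \<open>1\<close>,
  shows that for a universal pair all invariants are constant and each tensor of the
  representation is divergence free.

  Constancy of \<open>det b\<close> and \<open>div b = 0\<close> make \<open>\<phi>\<close> harmonic, and then the Laplacian of the constant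
  \<open>tr b = \<bar>F\<bar>\<^sup>2\<close> is \<open>2 \<bar>\<nabla>F\<bar>\<^sup>2\<close>, so \<open>F\<close> is constant.

  For the residual stress put \<open>T = S F\<^sup>T F S\<close>, the pull-back of the squared pushed-forward stress.
  It is divergence free, and \<open>S \<nabla>\<rho>\<close> vanishes on the boundary \<open>\<rho> = 0\<close>; differentiating this yields
  \<open>T : \<nabla>\<nabla>\<rho> = 0\<close> at boundary points. At the point farthest from the origin \<open>\<nabla>\<nabla>\<rho>\<close> is positive definite on
  the tangent plane, so the positive semidefinite tangential tensor \<open>T\<close> vanishes there, and hence
  so does the constant invariant \<open>I\<^sub>5\<close> everywhere.\<close>

section \<open>Iterated directional derivatives\<close>

text \<open>In reference coordinates the divergence of \<open>b\<close> is the Laplacian of \<phi>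
  plus \<open>F\<close> applied to the gradient of \<open>log |det F|\<close>; constancy of
  \<open>det b\<close> removes the second term. The squared stress is used instead of the stress for
  two reasons. It is quadratic in \<open>S\<close>, so the normal derivative of
  \<open>S \<nabla>\<rho>\<close> on the boundary enters only against
  \<open>S \<nabla>\<rho>\<close> itself and drops out, whereas for \<open>S\<close> alone it would
  survive. And it factors as \<open>K K\<^sup>T\<close>, so that the vanishing of one contraction
  forces \<open>K\<close> to vanish. The body is closed: derivatives are taken relative to
  \<open>B\<close> and could be ambiguous at the boundary. Every identity is therefore pulled back
  from the deformed body to \<open>B\<close>, where the directions that enter the body span the
  space and make such derivatives unique; a spatial derivative along \<open>axis j 1\<close> becomes
  one along \<open>Fi X *v axis j 1\<close>. Passing from zero derivative to constancy also takes an
  argument near the boundary, since connectedness is assumed of \<open>B\<close> and not of its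
  interior.\<close>

definition dir_deriv :: "'a::real_normed_vector \<Rightarrow> ('a \<Rightarrow> 'b::real_normed_vector) \<Rightarrow> 'a \<Rightarrow> 'b" where
  "dir_deriv v f = (\<lambda>x. frechet_derivative f (at x) v)"

lemma Cn_on_Suc_has_derivative:
  assumes "Cn_on (Suc n) U f" "x \<in> U"
  shows "(f has_derivative (\<lambda>v. dir_deriv v f x)) (at x)"
  using assms by (simp add: dir_deriv_def frechet_derivative_works[symmetric])

lemma Cn_on_Suc_dir_deriv: "Cn_on (Suc n) U f \<Longrightarrow> Cn_on n U (dir_deriv v f)"
  by (simp add: dir_deriv_def)

lemma has_derivative_imp_dir_deriv:
  "(f has_derivative f') (at x) \<Longrightarrow> dir_deriv v f x = f' v"
  by (simp add: dir_deriv_def frechet_derivative_at [symmetric])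

lemma Cn_on_subset: "Cn_on n U f \<Longrightarrow> V \<subseteq> U \<Longrightarrow> Cn_on n V f"
  by (induction n arbitrary: f) (auto intro: continuous_on_subset)

lemma Cn_on_imp_continuous_on: "Cn_on n U f \<Longrightarrow> continuous_on U f"
  by (cases n)
     (auto intro!: continuous_at_imp_continuous_on intro: differentiable_imp_continuous_within)

lemma Cn_on_const: "Cn_on n U (\<lambda>x. c)"
  by (induction n arbitrary: c) auto

lemma Cn_on_bounded_linear:
  assumes "bounded_linear f" shows "Cn_on n U f"
proof (cases n)
  case 0
  then show ?thesis using assms by (simp add: linear_continuous_on)
next
  case (Suc m)
  have d: "(f has_derivative f) (at x)" for x
    using assms by (rule bounded_linear_imp_has_derivative)
  then have "frechet_derivative f (at x) = f" for x
    by (metis frechet_derivative_at)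
  with Suc d show ?thesis by (auto simp: Cn_on_const differentiable_def)
qed

lemma smooth_on_bounded_linear: "bounded_linear f \<Longrightarrow> smooth_on A f"
  unfolding smooth_on_def by (intro ballI exI[of _ UNIV] exI[of _ f]) (simp add: Cn_on_bounded_linear)

lemma smooth_on_const: "smooth_on A (\<lambda>x. c)"
  unfolding smooth_on_def by (intro ballI exI[of _ UNIV] exI[of _ "\<lambda>_. c"]) (simp add: Cn_on_const)

lemma smooth_onE:
  assumes "smooth_on A f" "x \<in> A"
  obtains U g where "open U" "x \<in> U" "\<And>n. Cn_on n U g" "\<And>y. y \<in> U \<inter> A \<Longrightarrow> g y = f y"
proof -
  obtain U g where "open U" "x \<in> U" "\<forall>n. Cn_on n U g" "\<forall>y\<in>U \<inter> A. g y = f y"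
    using assms(1)[unfolded smooth_on_def, rule_format, OF assms(2)] by (elim exE conjE)
  then show thesis by (intro that[of U g]) simp_all
qed

text \<open>Fields on a closed set are smooth through local extensions to open sets. This turns the
  ordinary derivative of an extension into the derivative relative to \<open>A\<close> of the field
  itself.\<close>

lemma has_derivative_within_local_extension:
  assumes "open U" "x \<in> U" "x \<in> A" "\<And>y. y \<in> U \<inter> A \<Longrightarrow> g y = f y" "(g has_derivative D) (at x)"
  shows "(f has_derivative D) (at x within A)"
proof -
  obtain e where "e > 0" "ball x e \<subseteq> U" using assms(1,2) openE by blast
  then show ?thesis
    using assms(3,4)
    by (intro has_derivative_transform_within[OF has_derivative_at_withinI[OF assms(5)], where d = e])
       (auto simp: dist_commute subset_eq)
qed

text \<open>Schwarz's argument: the second difference over the parallelogram with sides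
  \<open>t v\<close> and \<open>t w\<close> is symmetric in \<open>v\<close> and \<open>w\<close>.
  Two mean value steps turn it into \<open>t * t\<close> times either mixed derivative at a point
  that tends to \<open>x\<close>.\<close>

lemma mixed_second_derivatives_real:
  fixes f :: "'a::real_normed_vector \<Rightarrow> real"
  assumes "open U" "x \<in> U"
    and f: "\<And>y. y \<in> U \<Longrightarrow> (f has_derivative f' y) (at y)"
    and v: "\<And>y. y \<in> U \<Longrightarrow> ((\<lambda>y. f' y v) has_derivative fv y) (at y)"
    and w: "\<And>y. y \<in> U \<Longrightarrow> ((\<lambda>y. f' y w) has_derivative fw y) (at y)"
    and cv: "continuous (at x) (\<lambda>y. fv y w)"
    and cw: "continuous (at x) (\<lambda>y. fw y v)"
  shows "fv x w = fw x v"
proof -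
  \<comment> \<open>Quantified over \<open>v\<close>, \<open>w\<close> and \<open>fv\<close> so that
    it applies again with the two directions exchanged.\<close>
  have step: "\<exists>\<xi> \<eta>. 0 < \<xi> \<and> \<xi> < t \<and> 0 < \<eta> \<and> \<eta> < t \<and>
      f (x + t *\<^sub>R v + t *\<^sub>R w) - f (x + t *\<^sub>R v) - f (x + t *\<^sub>R w) + f x
      = t * t * fv (x + \<xi> *\<^sub>R v + \<eta> *\<^sub>R w) w"
    if t: "0 < t" and inU: "\<And>a b. \<lbrakk>0 \<le> a; a \<le> t; 0 \<le> b; b \<le> t\<rbrakk> \<Longrightarrow> x + a *\<^sub>R v + b *\<^sub>R w \<in> U"
      and v: "\<And>y. y \<in> U \<Longrightarrow> ((\<lambda>y. f' y v) has_derivative fv y) (at y)"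
    for t v w fv
  proof -
    let ?p = "\<lambda>s. f (x + s *\<^sub>R v + t *\<^sub>R w) - f (x + s *\<^sub>R v)"
    have lin: "f' y (c *\<^sub>R z) = c * f' y z" if "y \<in> U" for y c z
      using has_derivative_linear[OF f[OF that]] by (simp add: linear_scale)
    have linv: "fv y (c *\<^sub>R z) = c * fv y z" if "y \<in> U" for y c z
      using has_derivative_linear[OF v[OF that]] by (simp add: linear_scale)
    have "(?p has_real_derivative f' (x + s *\<^sub>R v + t *\<^sub>R w) v - f' (x + s *\<^sub>R v) v) (at s)"
      if "0 \<le> s" "s \<le> t" for s
    proof -
      have i1: "x + s *\<^sub>R v + t *\<^sub>R w \<in> U" using inU[of s t] that t by simp
      have i2: "x + s *\<^sub>R v \<in> U" using inU[of s 0] that t by simp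
      have "((\<lambda>s. f (x + s *\<^sub>R v + t *\<^sub>R w)) has_derivative (\<lambda>h. f' (x + s *\<^sub>R v + t *\<^sub>R w) (h *\<^sub>R v))) (at s)"
        by (rule has_derivative_compose[where f = "\<lambda>s. x + s *\<^sub>R v + t *\<^sub>R w" and g = f, OF _ f[OF i1]]) (auto intro!: derivative_eq_intros)
      moreover have "((\<lambda>s. f (x + s *\<^sub>R v)) has_derivative (\<lambda>h. f' (x + s *\<^sub>R v) (h *\<^sub>R v))) (at s)"
        by (rule has_derivative_compose[where f = "\<lambda>s. x + s *\<^sub>R v" and g = f, OF _ f[OF i2]]) (auto intro!: derivative_eq_intros)
      ultimately have "(?p has_derivative (\<lambda>h. f' (x + s *\<^sub>R v + t *\<^sub>R w) (h *\<^sub>R v) - f' (x + s *\<^sub>R v) (h *\<^sub>R v))) (at s)"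
        by (rule has_derivative_diff)
      then show ?thesis
        unfolding has_field_derivative_def
        by (rule has_derivative_eq_rhs) (simp add: fun_eq_iff lin[OF i1] lin[OF i2] right_diff_distrib mult.commute)
    qed
    from MVT2[OF t this] obtain \<xi> where xi: "0 < \<xi>" "\<xi> < t"
      and e1: "?p t - ?p 0 = t * (f' (x + \<xi> *\<^sub>R v + t *\<^sub>R w) v - f' (x + \<xi> *\<^sub>R v) v)" by auto
    let ?q = "\<lambda>r. f' (x + \<xi> *\<^sub>R v + r *\<^sub>R w) v"
    have "(?q has_real_derivative fv (x + \<xi> *\<^sub>R v + r *\<^sub>R w) w) (at r)" if "0 \<le> r" "r \<le> t" for r
    proof -
      have i1: "x + \<xi> *\<^sub>R v + r *\<^sub>R w \<in> U" using inU[of \<xi> r] that xi by simp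
      have "(?q has_derivative (\<lambda>h. fv (x + \<xi> *\<^sub>R v + r *\<^sub>R w) (h *\<^sub>R w))) (at r)"
        by (rule has_derivative_compose[where f = "\<lambda>r. x + \<xi> *\<^sub>R v + r *\<^sub>R w" and g = "\<lambda>y. f' y v", OF _ v[OF i1]]) (auto intro!: derivative_eq_intros)
      then show ?thesis
        by (simp add: has_field_derivative_def linv i1 mult.commute[of _ "fv _ _"] mult_commute_abs)
    qed
    from MVT2[OF t this] obtain \<eta> where eta: "0 < \<eta>" "\<eta> < t"
      and e2: "?q t - ?q 0 = t * fv (x + \<xi> *\<^sub>R v + \<eta> *\<^sub>R w) w" by auto
    have "f (x + t *\<^sub>R v + t *\<^sub>R w) - f (x + t *\<^sub>R v) - f (x + t *\<^sub>R w) + f x = t * (?q t - ?q 0)"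
      using e1 by simp
    then show ?thesis using xi eta e2 by auto
  qed
  obtain r where r: "r > 0" "ball x r \<subseteq> U" using assms(1,2) openE by blast
  \<comment> \<open>Displacements with coefficients up to \<open>t\<close> stay below
    \<open>t * K\<close>; the summand 1 makes this strict even for \<open>v = w = 0\<close>.\<close>
  define K where "K = norm v + norm w + 1"
  have K: "K > 0" unfolding K_def by (smt (verit) norm_ge_zero)
  have near: "dist (x + a *\<^sub>R v + b *\<^sub>R w) x < t * K" if "0 \<le> a" "a \<le> t" "0 \<le> b" "b \<le> t" "0 < t" for a b t
  proof -
    have "norm (a *\<^sub>R v + b *\<^sub>R w) \<le> a * norm v + b * norm w"
      using that norm_triangle_ineq[of "a *\<^sub>R v" "b *\<^sub>R w"] by simp
    also have "\<dots> \<le> t * norm v + t * norm w"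
      using that by (intro add_mono mult_right_mono) auto
    also have "\<dots> < t * K" unfolding K_def using that by (simp add: algebra_simps)
    finally show ?thesis by (simp add: dist_norm algebra_simps)
  qed
  have "\<bar>fv x w - fw x v\<bar> < e" if e: "e > 0" for e
  proof -
    obtain d1 where d1: "d1 > 0" "\<And>y. dist y x < d1 \<Longrightarrow> \<bar>fv y w - fv x w\<bar> < e/2"
      using cv[unfolded continuous_at_eps_delta, rule_format, of "e/2"] e by (auto simp: dist_real_def)
    obtain d2 where d2: "d2 > 0" "\<And>y. dist y x < d2 \<Longrightarrow> \<bar>fw y v - fw x v\<bar> < e/2"
      using cw[unfolded continuous_at_eps_delta, rule_format, of "e/2"] e by (auto simp: dist_real_def)
    \<comment> \<open>\<open>t * K\<close> must not exceed the radius of the ball inside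
      \<open>U\<close> or either of the two continuity radii.\<close>
    define t where "t = min r (min d1 d2) / K"
    have t: "t > 0" "t * K = min r (min d1 d2)" using K r d1 d2 by (auto simp: t_def)
    have inU: "x + a *\<^sub>R v + b *\<^sub>R w \<in> U" if "0 \<le> a" "a \<le> t" "0 \<le> b" "b \<le> t" for a b
      using near[OF that t(1)] t r(2) by (auto simp: dist_commute)
    have inU': "x + a *\<^sub>R w + b *\<^sub>R v \<in> U" if "0 \<le> a" "a \<le> t" "0 \<le> b" "b \<le> t" for a b
      using inU[of b a] that by (simp add: algebra_simps)
    obtain a b where ab: "0 < a" "a < t" "0 < b" "b < t"
      "f (x + t *\<^sub>R v + t *\<^sub>R w) - f (x + t *\<^sub>R v) - f (x + t *\<^sub>R w) + f x
      = t * t * fv (x + a *\<^sub>R v + b *\<^sub>R w) w" using step[OF t(1) inU v] by auto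
    obtain c d where cd: "0 < c" "c < t" "0 < d" "d < t"
      "f (x + t *\<^sub>R w + t *\<^sub>R v) - f (x + t *\<^sub>R w) - f (x + t *\<^sub>R v) + f x
      = t * t * fw (x + c *\<^sub>R w + d *\<^sub>R v) v" using step[OF t(1) inU' w] by auto
    have "t * t * fv (x + a *\<^sub>R v + b *\<^sub>R w) w = t * t * fw (x + d *\<^sub>R v + c *\<^sub>R w) v"
      using ab(5) cd(5) by (simp add: algebra_simps)
    then have "fv (x + a *\<^sub>R v + b *\<^sub>R w) w = fw (x + d *\<^sub>R v + c *\<^sub>R w) v" using t by simp
    moreover have "\<bar>fv (x + a *\<^sub>R v + b *\<^sub>R w) w - fv x w\<bar> < e/2"
      using near[of a t b] ab t by (intro d1(2)) auto
    moreover have "\<bar>fw (x + d *\<^sub>R v + c *\<^sub>R w) v - fw x v\<bar> < e/2"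
      using near[of d t c] cd t by (intro d2(2)) auto
    ultimately show ?thesis by linarith
  qed
  then show ?thesis using dense_eq0_I[of "fv x w - fw x v"] by (metis eq_iff_diff_eq_0 less_imp_le)
qed

text \<open>Inner products with a fixed \<open>k\<close> reduce the claim to real functions, for
  which the mean value theorem holds.\<close>

lemma dir_deriv_commute:
  fixes f :: "'a::real_normed_vector \<Rightarrow> 'b::real_inner"
  assumes "open U" "x \<in> U" "Cn_on 2 U f"
  shows "dir_deriv v (dir_deriv w f) x = dir_deriv w (dir_deriv v f) x"
proof -
  have C: "Cn_on (Suc (Suc 0)) U f" using assms(3) by (simp add: numeral_2_eq_2)
  have C1: "Cn_on (Suc 0) U (dir_deriv v f)" for v by (rule Cn_on_Suc_dir_deriv[OF C])
  have C0: "continuous (at x) (dir_deriv u (dir_deriv v f))" for u v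
    using Cn_on_Suc_dir_deriv[OF C1] assms(1,2) by (simp add: continuous_on_eq_continuous_at)
  have d: "((\<lambda>y. dir_deriv v f y \<bullet> k) has_derivative (\<lambda>h. dir_deriv h (dir_deriv v f) y \<bullet> k)) (at y)"
    if "y \<in> U" for v k y
    by (rule has_derivative_inner_left[OF Cn_on_Suc_has_derivative[OF C1 that]])
  have "dir_deriv w (dir_deriv v f) x \<bullet> k = dir_deriv v (dir_deriv w f) x \<bullet> k" for k
    by (rule mixed_second_derivatives_real[OF assms(1,2)
          has_derivative_inner_left[OF Cn_on_Suc_has_derivative[OF C]] d d])
       (auto intro!: continuous_intros C0)
  then show ?thesis by (metis inner_commute vector_eq_ldot)
qed

section \<open>Calculus on bodies\<close>

definition gradient :: "(real^'n \<Rightarrow> real) \<Rightarrow> real^'n \<Rightarrow> real^'n" where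
  "gradient \<rho> x = (\<chi> i. dir_deriv (axis i 1) \<rho> x)"

lemma gradient_unique:
  assumes "GDERIV \<rho> x :> g" shows "gradient \<rho> x = g"
proof -
  have "dir_deriv v \<rho> x = v \<bullet> g" for v
    using assms has_derivative_imp_dir_deriv unfolding gderiv_def by blast
  then show ?thesis by (simp add: gradient_def vec_eq_iff inner_axis')
qed

lemma Cn_on_Suc_GDERIV:
  fixes \<rho> :: "real^'n \<Rightarrow> real"
  assumes "Cn_on (Suc n) U \<rho>" "x \<in> U"
  shows "GDERIV \<rho> x :> gradient \<rho> x"
proof -
  note d = Cn_on_Suc_has_derivative[OF assms]
  have "dir_deriv v \<rho> x = v \<bullet> gradient \<rho> x" for v
  proof -
    have "dir_deriv v \<rho> x = dir_deriv (\<Sum>i\<in>UNIV. v $ i *\<^sub>R axis i 1) \<rho> x"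
      by (simp add: basis_expansion scalar_mult_eq_scaleR[symmetric])
    also have "\<dots> = (\<Sum>i\<in>UNIV. v $ i * dir_deriv (axis i 1) \<rho> x)"
      by (simp add: linear_sum[OF has_derivative_linear[OF d]] linear_scale[OF has_derivative_linear[OF d]])
    finally show ?thesis by (simp add: gradient_def inner_vec_def)
  qed
  with d show ?thesis by (simp add: gderiv_def)
qed

lemma has_derivative_vec:
  fixes f :: "'a::real_normed_vector \<Rightarrow> ('b::euclidean_space)^'n"
  assumes "\<And>i. ((\<lambda>x. f x $ i) has_derivative (\<lambda>h. f' h $ i)) (at a within S)"
  shows "(f has_derivative f') (at a within S)"
  unfolding has_derivative_componentwise_within[of f]
proof
  fix b :: "'b^'n" assume "b \<in> Basis"
  then obtain i u where "b = axis i u" by (auto simp: Basis_vec_def)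
  then show "((\<lambda>x. f x \<bullet> b) has_derivative (\<lambda>h. f' h \<bullet> b)) (at a within S)"
    using has_derivative_inner_left[OF assms, of i u] by (simp add: inner_axis)
qed

text \<open>The function in \<open>local_defining_function\<close> is smooth only through local
  extensions and is attached to one point. A chart replaces it by a function that is itself
  \<open>Cn_on\<close> for every \<open>n\<close>, and records the normal at every boundary point of
  \<open>V\<close>, because the traction condition will be differentiated along the
  boundary.\<close>

locale boundary_chart =
  fixes B V :: "(real^3) set" and \<rho> :: "real^3 \<Rightarrow> real"
  assumes closed_B: "closed B"
    and open_V: "open V"
    and Cn_\<rho>: "\<And>n. Cn_on n V \<rho>"
    and gradient_nonzero: "\<And>x. x \<in> V \<Longrightarrow> gradient \<rho> x \<noteq> 0"
    and B_Int_V: "B \<inter> V = {x \<in> V. \<rho> x \<le> 0}"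
    and normal: "\<And>x. \<lbrakk>x \<in> V; x \<in> frontier B\<rbrakk> \<Longrightarrow>
      outward_unit_normal B x (gradient \<rho> x /\<^sub>R norm (gradient \<rho> x))"

lemma body_boundary_chart:
  assumes "body B" "p \<in> frontier B"
  obtains V \<rho> where "boundary_chart B V \<rho>" "p \<in> V"
proof -
  obtain U \<rho>0 where l: "local_defining_function B p U \<rho>0"
    using assms unfolding body_def by blast
  then have U: "open U" "p \<in> U" "smooth_on U \<rho>0" "\<And>x. x \<in> U \<Longrightarrow> \<exists>g. g \<noteq> 0 \<and> GDERIV \<rho>0 x :> g"
    "B \<inter> U = {x\<in>U. \<rho>0 x \<le> 0}"
    unfolding local_defining_function_def by auto
  obtain W \<rho> where W: "open W" "p \<in> W" "\<And>n. Cn_on n W \<rho>" "\<And>y. y \<in> W \<inter> U \<Longrightarrow> \<rho> y = \<rho>0 y"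
    by (rule smooth_onE[OF U(3,2)]) (rule that)
  define V where "V = W \<inter> U"
  have op: "open V" using U(1) W(1) by (simp add: V_def open_Int)
  have grad: "gradient \<rho> x \<noteq> 0 \<and> GDERIV \<rho>0 x :> gradient \<rho> x" if x: "x \<in> V" for x
  proof -
    obtain g where g: "g \<noteq> 0" "GDERIV \<rho>0 x :> g" using U(4) x V_def by blast
    have "GDERIV \<rho> x :> g"
      using g(2) unfolding gderiv_def
      by (rule has_derivative_transform_within_open[OF _ op x]) (use W(4) V_def in auto)
    with g show ?thesis using gradient_unique by metis
  qed
  have "boundary_chart B V \<rho>"
  proof
    show "closed B" using assms(1) by (simp add: body_def)
    show "open V" by (rule op)
    show "Cn_on n V \<rho>" for n by (rule Cn_on_subset[OF W(3)]) (simp add: V_def)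
    show "gradient \<rho> x \<noteq> 0" if "x \<in> V" for x using grad that by blast
    show "B \<inter> V = {x \<in> V. \<rho> x \<le> 0}" using U(5) W(4) by (auto simp: V_def)
    show "outward_unit_normal B x (gradient \<rho> x /\<^sub>R norm (gradient \<rho> x))" if x: "x \<in> V" "x \<in> frontier B" for x
    proof -
      \<comment> \<open>A local defining function at \<open>p\<close> is one at every other point of
        its open set.\<close>
      have "local_defining_function B x U \<rho>0"
        using l x unfolding local_defining_function_def V_def by auto
      then show ?thesis using grad[OF x(1)] unfolding outward_unit_normal_def by blast
    qed
  qed
  moreover have "p \<in> V" using U W by (simp add: V_def)
  ultimately show thesis by (rule that)
qed

section \<open>Defining functions near the boundary and farthest points\<close>

context boundary_chart
begin

lemma GDERIV_\<rho>: "x \<in> V \<Longrightarrow> GDERIV \<rho> x :> gradient \<rho> x"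
  using Cn_on_Suc_GDERIV[OF Cn_\<rho>] .

lemma continuous_on_\<rho>: "continuous_on V \<rho>"
  using Cn_on_imp_continuous_on[OF Cn_\<rho>] .

lemma has_derivative_gradient:
  assumes "x \<in> V" shows "(gradient \<rho> has_derivative (\<lambda>h. \<chi> i. dir_deriv h (dir_deriv (axis i 1) \<rho>) x)) (at x)"
  by (rule has_derivative_vec)
     (simp add: gradient_def, rule Cn_on_Suc_has_derivative[OF Cn_on_Suc_dir_deriv[OF Cn_\<rho>] assms])

lemma continuous_on_gradient: "continuous_on V (gradient \<rho>)"
  using has_derivative_gradient
  by (metis continuous_at_imp_continuous_on has_derivative_continuous)

lemma DERIV_line:
  assumes "x \<in> V"
  shows "((\<lambda>t. \<rho> (x + t *\<^sub>R v)) has_real_derivative (v \<bullet> gradient \<rho> x)) (at 0)"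
proof -
  have "((\<lambda>t. \<rho> (x + t *\<^sub>R v)) has_derivative (\<lambda>h. (h *\<^sub>R v) \<bullet> gradient \<rho> x)) (at 0)"
    by (rule has_derivative_compose[where f = "\<lambda>t. x + t *\<^sub>R v" and g = \<rho>])
       (use GDERIV_\<rho>[OF assms] in \<open>auto intro!: derivative_eq_intros simp: gderiv_def\<close>)
  then show ?thesis
    unfolding has_field_derivative_def by (rule has_derivative_eq_rhs) (simp add: fun_eq_iff)
qed

lemma negative_imp_interior: "\<lbrakk>x \<in> V; \<rho> x < 0\<rbrakk> \<Longrightarrow> x \<in> interior B"
proof (rule interiorI[of "V \<inter> \<rho> -` {..<0}"])
  show "open (V \<inter> \<rho> -` {..<0})"
    using continuous_on_open_vimage[OF open_V] continuous_on_\<rho> by (metis Int_commute open_lessThan)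
  show "V \<inter> \<rho> -` {..<0} \<subseteq> B" using B_Int_V by force
qed auto

lemma eventually_line_in_V:
  assumes "x \<in> V" shows "\<exists>e>0. \<forall>t. \<bar>t\<bar> < e \<longrightarrow> x + t *\<^sub>R v \<in> V"
proof -
  have "continuous (at 0) (\<lambda>t. x + t *\<^sub>R v)" by (intro continuous_intros)
  then have "((\<lambda>t. x + t *\<^sub>R v) \<longlongrightarrow> x) (at 0)" by (simp add: continuous_within)
  then have "\<forall>\<^sub>F t in at 0. x + t *\<^sub>R v \<in> V" using topological_tendstoD open_V assms by blast
  then obtain d where "d > 0" "\<forall>t. t \<noteq> 0 \<and> dist t 0 < d \<longrightarrow> x + t *\<^sub>R v \<in> V"
    by (auto simp: eventually_at)
  then show ?thesis using assms by (intro exI[of _ d]) (metis add.right_neutral dist_0_norm dist_commute real_norm_def scaleR_zero_left)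
qed

text \<open>These inward directions form an open half-space. They yield uniqueness of derivatives
  relative to the body and the first-order condition at a farthest point.\<close>

lemma descending_line:
  assumes "x \<in> V" "x \<in> B" "v \<bullet> gradient \<rho> x < 0"
  shows "\<exists>e>0. \<forall>t. 0 < t \<and> t < e \<longrightarrow> x + t *\<^sub>R v \<in> interior B"
proof -
  obtain d where d: "d > 0" "\<And>h. \<lbrakk>h > 0; h < d\<rbrakk> \<Longrightarrow> \<rho> (x + h *\<^sub>R v) < \<rho> x"
    using DERIV_neg_dec_right[OF DERIV_line[OF assms(1)] assms(3)] by auto
  obtain e where e: "e > 0" "\<And>t. \<bar>t\<bar> < e \<Longrightarrow> x + t *\<^sub>R v \<in> V"
    using eventually_line_in_V[OF assms(1)] by blast
  have "\<rho> x \<le> 0" using assms B_Int_V by blast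
  then show ?thesis using d e
    by (intro exI[of _ "min d e"]) (force intro!: negative_imp_interior)
qed

lemma ascending_line:
  assumes "x \<in> V" "v \<bullet> gradient \<rho> x > 0"
  shows "\<exists>e>0. \<forall>t. 0 < t \<and> t < e \<longrightarrow> x + t *\<^sub>R v \<in> V \<and> \<rho> (x + t *\<^sub>R v) > \<rho> x"
proof -
  obtain d where d: "d > 0" "\<And>h. \<lbrakk>h > 0; h < d\<rbrakk> \<Longrightarrow> \<rho> (x + h *\<^sub>R v) > \<rho> x"
    using DERIV_pos_inc_right[OF DERIV_line[OF assms(1)] assms(2)] by auto
  obtain e where e: "e > 0" "\<And>t. \<bar>t\<bar> < e \<Longrightarrow> x + t *\<^sub>R v \<in> V"
    using eventually_line_in_V[OF assms(1)] by blast
  then show ?thesis using d by (intro exI[of _ "min d e"]) auto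
qed

text \<open>For the converse: the gradient does not vanish, so at a zero of \<rho> a small step
  along it makes \<rho> positive and leaves \<open>B\<close>; hence the point is not
  interior.\<close>

lemma frontier_iff:
  assumes "x \<in> V" shows "x \<in> frontier B \<longleftrightarrow> \<rho> x = 0"
proof
  assume f: "x \<in> frontier B"
  then have "x \<in> B" "x \<notin> interior B" using closed_B by (auto simp: frontier_def)
  then show "\<rho> x = 0" using negative_imp_interior[OF assms] B_Int_V assms by force
next
  assume z: "\<rho> x = 0"
  then have xB: "x \<in> B" using B_Int_V assms by force
  have "x \<notin> interior B"
  proof
    assume "x \<in> interior B"
    then obtain r where r: "r > 0" "ball x r \<subseteq> B" by (meson mem_interior)
    let ?g = "gradient \<rho> x"
    have g: "norm ?g > 0" using gradient_nonzero[OF assms] by simp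
    then have "?g \<bullet> ?g > 0" by simp
    from ascending_line[OF assms this] obtain e where
      e: "e > 0" "\<And>t. \<lbrakk>0 < t; t < e\<rbrakk> \<Longrightarrow> x + t *\<^sub>R ?g \<in> V \<and> \<rho> (x + t *\<^sub>R ?g) > \<rho> x" by blast
    define t where "t = min e (r / norm ?g) / 2"
    have t: "0 < t" "t < e" "t < r / norm ?g" using e r g by (auto simp: t_def min_def field_simps)
    then have "x + t *\<^sub>R ?g \<in> ball x r" using g by (simp add: dist_norm field_simps)
    then have "x + t *\<^sub>R ?g \<in> B" using r by blast
    moreover have y: "x + t *\<^sub>R ?g \<in> V" "\<rho> (x + t *\<^sub>R ?g) > 0" using e(2)[OF t(1,2)] z by simp_all
    ultimately have "x + t *\<^sub>R ?g \<in> B \<inter> V" by blast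
    then show False unfolding B_Int_V using y by simp
  qed
  then show "x \<in> frontier B" using xB closed_B by (simp add: frontier_def)
qed

text \<open>A substitute for the implicit function theorem: with \<open>g\<close> the gradient,
  \<rho> has opposite signs at \<open>x + t (e + \<epsilon> g)\<close> and
  \<open>x + t (e - \<epsilon> g)\<close> for small \<open>t\<close>, so the intermediate value
  theorem finds a boundary point between them.\<close>

lemma frontier_points_near_tangent:
  assumes x: "x \<in> V" "x \<in> frontier B" and e: "e \<bullet> gradient \<rho> x = 0" and eps: "\<epsilon> > 0"
  shows "\<exists>d>0. \<forall>t. 0 < t \<and> t < d \<longrightarrow>
    (\<exists>s. \<bar>s\<bar> \<le> \<epsilon> * t \<and> x + t *\<^sub>R e + s *\<^sub>R gradient \<rho> x \<in> frontier B)"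
proof -
  let ?g = "gradient \<rho> x"
  have z: "\<rho> x = 0" using frontier_iff x by blast
  have g: "?g \<bullet> ?g > 0" using gradient_nonzero[OF x(1)] by simp
  have p: "(e + \<epsilon> *\<^sub>R ?g) \<bullet> ?g > 0" and m: "(e - \<epsilon> *\<^sub>R ?g) \<bullet> ?g < 0"
    using g e eps by (simp_all add: inner_add_left inner_diff_left)
  obtain d1 where d1: "d1 > 0" "\<And>t. \<lbrakk>0 < t; t < d1\<rbrakk> \<Longrightarrow> \<rho> (x + t *\<^sub>R (e + \<epsilon> *\<^sub>R ?g)) > 0"
    using DERIV_pos_inc_right[OF DERIV_line[OF x(1)] p] z by auto
  obtain d2 where d2: "d2 > 0" "\<And>t. \<lbrakk>0 < t; t < d2\<rbrakk> \<Longrightarrow> \<rho> (x + t *\<^sub>R (e - \<epsilon> *\<^sub>R ?g)) < 0"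
    using DERIV_neg_dec_right[OF DERIV_line[OF x(1)] m] z by auto
  obtain r where r: "r > 0" "ball x r \<subseteq> V" using open_V x openE by blast
  define K where "K = norm e + \<epsilon> * norm ?g + 1"
  have K: "K > 0" unfolding K_def using eps by (smt (verit) norm_ge_zero mult_nonneg_nonneg)
  have inV: "x + t *\<^sub>R e + s *\<^sub>R ?g \<in> V" if "0 < t" "t < r / K" "\<bar>s\<bar> \<le> \<epsilon> * t" for s t
  proof -
    have "norm (t *\<^sub>R e + s *\<^sub>R ?g) \<le> t * norm e + \<bar>s\<bar> * norm ?g"
      using norm_triangle_ineq[of "t *\<^sub>R e" "s *\<^sub>R ?g"] that by simp
    also have "\<dots> \<le> t * norm e + (\<epsilon> * t) * norm ?g" using that by (intro add_left_mono mult_right_mono) auto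
    also have "\<dots> \<le> t * K" using that by (simp add: K_def algebra_simps)
    also have "\<dots> < r" using that K by (simp add: field_simps)
    finally have "dist (x + (t *\<^sub>R e + s *\<^sub>R ?g)) x < r" by (simp add: dist_norm)
    then have "x + (t *\<^sub>R e + s *\<^sub>R ?g) \<in> ball x r" by (simp add: dist_commute)
    then show ?thesis using r(2) by (metis add.assoc subsetD)
  qed
  define d where "d = min (r / K) (min d1 d2)"
  have d: "d > 0" using r K d1 d2 by (simp add: d_def)
  have "\<exists>s. \<bar>s\<bar> \<le> \<epsilon> * t \<and> x + t *\<^sub>R e + s *\<^sub>R ?g \<in> frontier B" if t: "0 < t" "t < d" for t
  proof -
    let ?f = "\<lambda>s. \<rho> (x + t *\<^sub>R e + s *\<^sub>R ?g)"
    have tr: "t < r / K" using t by (simp add: d_def)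
    have lo: "?f (- (\<epsilon> * t)) \<le> 0"
      using d2(2)[of t] t by (simp add: d_def algebra_simps)
    have hi: "0 \<le> ?f (\<epsilon> * t)"
      using d1(2)[of t] t by (simp add: d_def algebra_simps)
    have "continuous_on {- (\<epsilon> * t)..\<epsilon> * t} ?f"
      by (rule continuous_on_compose2[OF continuous_on_\<rho>])
         (use inV[OF t(1) tr] in \<open>auto intro!: continuous_intros simp: abs_le_iff\<close>)
    from IVT'[OF lo hi _ this] obtain s where s: "- (\<epsilon> * t) \<le> s" "s \<le> \<epsilon> * t" "?f s = 0"
      using eps t by auto
    then have "\<bar>s\<bar> \<le> \<epsilon> * t" by auto
    then show ?thesis using s(3) inV[OF t(1) tr] frontier_iff by blast
  qed
  then show ?thesis using d by blast
qed

text \<open>Boundary points belong to \<open>B\<close>, so the derivative relative to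
  \<open>B\<close> may be tested on them. Those close to \<open>x + t e\<close> give a zero
  difference quotient, up to an error that vanishes with the aperture of the cone around
  \<open>e\<close>.\<close>

lemma tangential_derivative_zero:
  fixes u :: "real^3 \<Rightarrow> 'b::real_normed_vector"
  assumes x: "x \<in> V" "x \<in> frontier B" and e: "e \<bullet> gradient \<rho> x = 0"
    and u: "(u has_derivative u') (at x within B)"
    and W: "open W" "x \<in> W" "\<And>y. \<lbrakk>y \<in> W; y \<in> frontier B\<rbrakk> \<Longrightarrow> u y = 0"
  shows "u' e = 0"
proof -
  let ?g = "gradient \<rho> x"
  define K where "K = norm (u' ?g) + norm e + norm ?g"
  have lin: "linear u'" using u has_derivative_linear by blast
  \<comment> \<open>\<eta> serves twice: as aperture for the boundary points and as tolerance in the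
    derivative.\<close>
  have main: "norm (u' e) \<le> \<eta> * K" if eta: "0 < \<eta>" "\<eta> < 1" for \<eta>
  proof -
    obtain d1 where d1: "d1 > 0" "\<And>y. \<lbrakk>y \<in> B; norm (y - x) < d1\<rbrakk> \<Longrightarrow> norm (u y - u x - u' (y - x)) \<le> \<eta> * norm (y - x)"
      using u eta(1) unfolding has_derivative_within_alt by blast
    obtain r where r: "r > 0" "ball x r \<subseteq> W" using W openE by blast
    obtain d2 where d2: "d2 > 0" "\<And>t. \<lbrakk>0 < t; t < d2\<rbrakk> \<Longrightarrow>
        (\<exists>s. \<bar>s\<bar> \<le> \<eta> * t \<and> x + t *\<^sub>R e + s *\<^sub>R ?g \<in> frontier B)"
      using frontier_points_near_tangent[OF x e eta(1)] by blast
    define M where "M = norm e + norm ?g + 1"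
    have M: "M > 0" unfolding M_def by (smt (verit) norm_ge_zero)
    define m where "m = min r d1"
    have m: "m > 0" using r d1 by (simp add: m_def)
    define q where "q = m / M"
    have "q > 0" using m M by (simp add: q_def)
    define t where "t = min d2 q / 2"
    have "0 < t" "t < d2" "t < q" using d2(1) \<open>q > 0\<close> by (auto simp: t_def min_def)
    then have t: "0 < t" "t < d2" "t * M < min r d1" using M by (auto simp: q_def m_def[symmetric] pos_less_divide_eq)
    obtain s where s: "\<bar>s\<bar> \<le> \<eta> * t" "x + t *\<^sub>R e + s *\<^sub>R ?g \<in> frontier B" using d2(2) t by blast
    let ?y = "x + t *\<^sub>R e + s *\<^sub>R ?g"
    have st: "\<bar>s\<bar> \<le> t" using s(1) eta t(1) by (smt (verit) mult_left_le_one_le)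
    have n: "norm (?y - x) \<le> t * (norm e + norm ?g)"
    proof -
      have "norm (t *\<^sub>R e + s *\<^sub>R ?g) \<le> t * norm e + \<bar>s\<bar> * norm ?g"
        using norm_triangle_ineq[of "t *\<^sub>R e" "s *\<^sub>R ?g"] t by simp
      also have "\<dots> \<le> t * norm e + t * norm ?g" using st by (intro add_left_mono mult_right_mono) auto
      finally show ?thesis by (simp add: algebra_simps)
    qed
    then have n': "norm (?y - x) < min r d1" using t(1,3) unfolding M_def by (smt (verit) mult_left_mono)
    have yB: "?y \<in> B" using s(2) closed_B by (simp add: frontier_def)
    have uy: "u ?y = 0" using W(3)[OF _ s(2)] r(2) n' by (auto simp: dist_norm subset_iff norm_minus_commute)
    have ux: "u x = 0" using W(2,3) x by blast
    have "norm (u' (?y - x)) \<le> \<eta> * norm (?y - x)"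
      using d1(2)[OF yB] n' uy ux by (simp add: norm_minus_commute)
    also have "\<dots> \<le> \<eta> * (t * (norm e + norm ?g))" using n eta by simp
    finally have a: "norm (u' (t *\<^sub>R e + s *\<^sub>R ?g)) \<le> \<eta> * (t * (norm e + norm ?g))" by (simp add: algebra_simps)
    have "t * norm (u' e) = norm (u' (t *\<^sub>R e + s *\<^sub>R ?g) - s *\<^sub>R u' ?g)"
      using t(1) by (simp add: linear_add[OF lin] linear_scale[OF lin])
    also have "\<dots> \<le> norm (u' (t *\<^sub>R e + s *\<^sub>R ?g)) + \<bar>s\<bar> * norm (u' ?g)"
      using norm_triangle_ineq4[of "u' (t *\<^sub>R e + s *\<^sub>R ?g)" "s *\<^sub>R u' ?g"] by simp
    also have "\<dots> \<le> \<eta> * (t * (norm e + norm ?g)) + (\<eta> * t) * norm (u' ?g)"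
      using a s(1) by (intro add_mono mult_right_mono) auto
    also have "\<dots> = t * (\<eta> * K)" by (simp add: K_def algebra_simps)
    finally show ?thesis using t(1) by simp
  qed
  have "norm (u' e) \<le> 0 + \<epsilon>" if "\<epsilon> > 0" for \<epsilon>
  proof -
    have K0: "K \<ge> 0" by (simp add: K_def)
    \<comment> \<open>Chosen to make \<open>\<eta> * K\<close> at most \<epsilon>;
      \<open>K + 1\<close> avoids division by zero and the bound 1/2 keeps \<eta> below 1.\<close>
    define \<eta> where "\<eta> = min (1/2) (\<epsilon> / (K + 1))"
    have "0 < \<eta>" "\<eta> < 1" "\<eta> \<le> \<epsilon> / (K + 1)" using that K0 by (auto simp: \<eta>_def)
    moreover from this have "\<eta> * K \<le> \<epsilon> / (K + 1) * K" using K0 by (intro mult_right_mono) auto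
    moreover have "\<epsilon> / (K + 1) * K \<le> \<epsilon>" using K0 that by (simp add: field_simps)
    ultimately show ?thesis using main[of \<eta>] by linarith
  qed
  then show ?thesis using field_le_epsilon norm_le_zero_iff by blast
qed

text \<open>A Lagrange multiplier rule with sign. No direction into the body increases the norm to
  first order; by approximation no tangent direction does, so the tangential part of
  \<open>p\<close> is orthogonal to itself.\<close>

lemma farthest_point_gradient:
  assumes p: "p \<in> V" "p \<in> frontier B" and far: "\<And>y. y \<in> B \<Longrightarrow> norm y \<le> norm p"
  obtains c where "c \<ge> 0" "p = c *\<^sub>R gradient \<rho> p"
proof -
  let ?g = "gradient \<rho> p"
  have pB: "p \<in> B" using p closed_B by (simp add: frontier_def)
  have g: "?g \<bullet> ?g > 0" using gradient_nonzero[OF p(1)] by simp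
  have fo: "p \<bullet> v \<le> 0" if v: "v \<bullet> ?g < 0" for v
  proof -
    obtain e where e: "e > 0" "\<And>t. \<lbrakk>0 < t; t < e\<rbrakk> \<Longrightarrow> p + t *\<^sub>R v \<in> interior B"
      using descending_line[OF p(1) pB v] by blast
    then have "norm (p + (e/2) *\<^sub>R v) \<le> norm p" using far interior_subset[of B] by (simp add: subset_iff)
    then have "(p + (e/2) *\<^sub>R v) \<bullet> (p + (e/2) *\<^sub>R v) \<le> p \<bullet> p" by (simp add: norm_le)
    then have "e * (p \<bullet> v) + (e/2)\<^sup>2 * (v \<bullet> v) \<le> 0"
      by (simp add: inner_add inner_commute power2_eq_square algebra_simps)
    moreover have "(e/2)\<^sup>2 * (v \<bullet> v) \<ge> 0" by simp
    ultimately have "e * (p \<bullet> v) \<le> 0" by linarith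
    then show ?thesis using e(1) by (simp add: mult_le_0_iff)
  qed
  have c0: "p \<bullet> ?g \<ge> 0" using fo[of "- ?g"] g by simp
  have tang: "p \<bullet> w \<le> 0" if w: "w \<bullet> ?g = 0" for w
  proof -
    have "p \<bullet> w \<le> 0 + \<epsilon>" if "\<epsilon> > 0" for \<epsilon>
    proof -
      define k where "k = \<epsilon> / (p \<bullet> ?g + 1)"
      have k: "k > 0" using that c0 by (simp add: k_def)
      \<comment> \<open>Tilting \<open>w\<close> by a small multiple of the negative gradient makes
        it point into the body.\<close>
      have "p \<bullet> (w - k *\<^sub>R ?g) \<le> 0" using w g k by (intro fo) (simp add: inner_diff_left)
      then have "p \<bullet> w \<le> k * (p \<bullet> ?g)" by (simp add: inner_diff_right)
      also have "\<dots> \<le> \<epsilon>" using that c0 by (simp add: k_def field_simps)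
      finally show ?thesis by simp
    qed
    then show ?thesis by (rule field_le_epsilon)
  qed
  define c where "c = (p \<bullet> ?g) / (?g \<bullet> ?g)"
  let ?w = "p - c *\<^sub>R ?g"
  have w: "?w \<bullet> ?g = 0" using g by (simp add: c_def inner_diff_left)
  have "p \<bullet> ?w \<le> 0" by (rule tang[OF w])
  \<comment> \<open>\<open>p \<bullet> ?w\<close> equals \<open>?w \<bullet> ?w\<close>, since
    \<open>?w\<close> is orthogonal to the gradient.\<close>
  then have "?w \<bullet> ?w \<le> 0" using w by (simp add: inner_diff_left inner_diff_right inner_commute)
  then have "?w \<bullet> ?w = 0" using inner_ge_zero[of ?w] by linarith
  then have "?w = 0" by (simp only: inner_eq_zero_iff)
  then have "p = c *\<^sub>R ?g" by simp
  moreover have "c \<ge> 0" using c0 g by (simp add: c_def)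
  ultimately show thesis using that by blast
qed

text \<open>The second-order condition at a maximum of the norm, tested along the parabolas
  \<open>t \<mapsto> p + t e - s t\<^sup>2 g\<close>, which enter the body once \<open>2 s \<bar>g\<bar>\<^sup>2\<close> exceeds the Hessian of \<open>\<rho>\<close> along \<open>e\<close>.\<close>

lemma farthest_point_hessian:
  assumes p: "p \<in> V" "p \<in> frontier B" and far: "\<And>y. y \<in> B \<Longrightarrow> norm y \<le> norm p"
    and c: "c \<ge> 0" "p = c *\<^sub>R gradient \<rho> p"
    and H: "(gradient \<rho> has_derivative H) (at p)" and e: "e \<bullet> gradient \<rho> p = 0"
  shows "e \<bullet> e \<le> c * (e \<bullet> H e)"
proof -
  define g where "g = gradient \<rho> p"
  have g: "g \<bullet> g > 0" using gradient_nonzero[OF p(1)] by (simp add: g_def)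
  have eg: "e \<bullet> g = 0" "g \<bullet> e = 0" using e by (simp_all add: g_def inner_commute)
  have pe: "p \<bullet> e = 0" "p \<bullet> g = c * (g \<bullet> g)" using c eg by (simp_all add: g_def[symmetric])
  have z: "\<rho> p = 0" using frontier_iff p by blast
  have main: "e \<bullet> e \<le> 2 * s * (c * (g \<bullet> g))" if s: "e \<bullet> H e < 2 * s * (g \<bullet> g)" for s
  proof -
    define y where "y t = p + t *\<^sub>R e - (s * t\<^sup>2) *\<^sub>R g" for t
    have y0: "y 0 = p" by (simp add: y_def)
    have dy: "(y has_derivative (\<lambda>h. h *\<^sub>R (e - (2 * s * t) *\<^sub>R g))) (at t)" for t
      unfolding y_def
      by (auto intro!: derivative_eq_intros simp: algebra_simps power2_eq_square)
    have "continuous (at 0) y" using dy has_derivative_continuous by blast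
    then have "(y \<longlongrightarrow> p) (at 0)" by (simp add: continuous_within y0)
    then have "\<forall>\<^sub>F t in at 0. y t \<in> V" using topological_tendstoD open_V p(1) by blast
    then obtain d where d0: "d > 0" "\<forall>t. t \<noteq> 0 \<and> dist t 0 < d \<longrightarrow> y t \<in> V"
      by (auto simp: eventually_at)
    have d: "y t \<in> V" if "\<bar>t\<bar> < d" for t
      using d0 p(1) y0 that by (cases "t = 0") simp_all
    define q' where "q' t = (e - (2 * s * t) *\<^sub>R g) \<bullet> gradient \<rho> (y t)" for t
    have dq: "((\<lambda>t. \<rho> (y t)) has_real_derivative q' t) (at t)" if "\<bar>t\<bar> < d" for t
    proof -
      have "((\<lambda>t. \<rho> (y t)) has_derivative (\<lambda>h. (h *\<^sub>R (e - (2 * s * t) *\<^sub>R g)) \<bullet> gradient \<rho> (y t))) (at t)"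
        by (rule has_derivative_compose[OF dy]) (use GDERIV_\<rho>[OF d[OF that]] in \<open>simp add: gderiv_def\<close>)
      then show ?thesis unfolding has_field_derivative_def
        by (rule has_derivative_eq_rhs) (simp add: fun_eq_iff q'_def)
    qed
    have q0: "q' 0 = 0" by (simp add: q'_def y0 e)
    \<comment> \<open>This is the second derivative of \<rho> along the parabola at
      \<open>t = 0\<close>; its negativity drives \<rho> below 0 for small positive
      \<open>t\<close>.\<close>
    have "(q' has_real_derivative (e \<bullet> H e - 2 * s * (g \<bullet> g))) (at 0)"
    proof -
      have H': "(gradient \<rho> has_derivative H) (at (y 0))" using H y0 by simp
      have lin: "H (h *\<^sub>R v) = h *\<^sub>R H v" for h v using has_derivative_linear[OF H] by (simp add: linear_scale)
      have "((\<lambda>t. gradient \<rho> (y t)) has_derivative (\<lambda>h. H (h *\<^sub>R e))) (at 0)"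
        using has_derivative_compose[OF dy H'] by simp
      moreover have "((\<lambda>t. e - (2 * s * t) *\<^sub>R g) has_derivative (\<lambda>h. - ((2 * s * h) *\<^sub>R g))) (at 0)"
        by (auto intro!: derivative_eq_intros simp: algebra_simps)
      ultimately have "(q' has_derivative (\<lambda>h. (e - (2 * s * 0) *\<^sub>R g) \<bullet> H (h *\<^sub>R e) + (- ((2 * s * h) *\<^sub>R g)) \<bullet> gradient \<rho> (y 0))) (at 0)"
        unfolding q'_def by (intro has_derivative_inner)
      then show ?thesis unfolding has_field_derivative_def
        by (rule has_derivative_eq_rhs) (simp add: fun_eq_iff y0 lin g_def[symmetric] algebra_simps)
    qed
    from DERIV_neg_dec_right[OF this] s obtain d' where
      d': "d' > 0" "\<And>h. \<lbrakk>h > 0; h < d'\<rbrakk> \<Longrightarrow> q' h < 0" using q0 by auto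
    define t where "t = min d d' / 2"
    have t: "0 < t" "t < d" "t < d'" using d0 d' by (auto simp: t_def)
    have "\<exists>\<xi>. 0 < \<xi> \<and> \<xi> < t \<and> \<rho> (y t) - \<rho> (y 0) = (t - 0) * q' \<xi>"
      by (rule MVT2[OF t(1)]) (use t in \<open>auto intro!: dq\<close>)
    then have "\<rho> (y t) < 0" using d'(2) t z y0 by (auto simp: mult_less_0_iff)
    then have "y t \<in> B" using negative_imp_interior d t interior_subset by (metis abs_of_pos subsetD)
    then have "y t \<bullet> y t \<le> p \<bullet> p" using far by (simp add: norm_le[symmetric])
    \<comment> \<open>The linear term is absent because \<open>p\<close> is orthogonal to
      \<open>e\<close>; once the nonnegative fourth-order term is dropped, only terms in
      \<open>t\<^sup>2\<close> remain.\<close>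
    moreover have "y t \<bullet> y t = p \<bullet> p + t\<^sup>2 * (e \<bullet> e) + (s * t\<^sup>2)\<^sup>2 * (g \<bullet> g) - 2 * (s * t\<^sup>2) * (c * (g \<bullet> g))"
      unfolding y_def using eg pe
      by (simp add: inner_add inner_diff inner_commute power2_eq_square algebra_simps)
    moreover have "(s * t\<^sup>2)\<^sup>2 * (g \<bullet> g) \<ge> 0" by simp
    ultimately have "t\<^sup>2 * (e \<bullet> e) \<le> 2 * (s * t\<^sup>2) * (c * (g \<bullet> g))" by linarith
    then have "t\<^sup>2 * (e \<bullet> e) \<le> t\<^sup>2 * (2 * s * (c * (g \<bullet> g)))" by (simp add: algebra_simps)
    then show ?thesis using t(1) by simp
  qed
  have "e \<bullet> e \<le> c * (e \<bullet> H e) + \<epsilon>" if "\<epsilon> > 0" for \<epsilon>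
  proof -
    \<comment> \<open>The admissible \<open>s\<close> form an open half-line; this one exceeds its
      endpoint by so little that the factor \<open>c\<close> costs at most \<epsilon>.\<close>
    define s where "s = (e \<bullet> H e + \<epsilon> / (c + 1)) / (2 * (g \<bullet> g))"
    have s: "2 * s * (g \<bullet> g) = e \<bullet> H e + \<epsilon> / (c + 1)" using g by (simp add: s_def)
    then have "e \<bullet> e \<le> 2 * s * (c * (g \<bullet> g))" using that c(1) by (intro main) simp
    also have "\<dots> = c * (2 * s * (g \<bullet> g))" by simp
    also have "\<dots> = c * (e \<bullet> H e) + c * (\<epsilon> / (c + 1))" unfolding s by (simp add: algebra_simps)
    also have "c * (\<epsilon> / (c + 1)) \<le> \<epsilon>" using that c(1) by (simp add: field_simps)
    finally show ?thesis by simp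
  qed
  then show ?thesis by (rule field_le_epsilon)
qed

end

section \<open>Uniqueness of derivatives and constancy on closed bodies\<close>

lemma body_frontier_or_interior:
  assumes "body B" "x \<in> B" shows "x \<in> frontier B \<or> x \<in> interior B"
  using assms closure_subset[of B] by (auto simp: frontier_def)

text \<open>Both derivatives agree on every direction along which a short segment lies in
  \<open>B\<close>. At a boundary point these include an open half-space, which spans; for a set
  without such room the derivative relative to it need not be unique.\<close>

lemma body_has_derivative_unique:
  fixes f :: "real^3 \<Rightarrow> 'b::real_normed_vector"
  assumes "body B" "x \<in> B"
    and L: "(f has_derivative L) (at x within B)" and M: "(f has_derivative M) (at x within B)"
  shows "L = M"
proof -
  have "\<exists>g. g \<noteq> 0 \<and> (\<forall>v. v \<bullet> g < 0 \<longrightarrow> (\<exists>e>0. \<forall>t. 0 < t \<and> t < e \<longrightarrow> x + t *\<^sub>R v \<in> B))"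
    using body_frontier_or_interior[OF assms(1,2)]
  proof
    assume "x \<in> frontier B"
    then obtain V \<rho> where c: "boundary_chart B V \<rho>" and x: "x \<in> V"
      using body_boundary_chart[OF assms(1)] by metis
    show ?thesis
      using boundary_chart.descending_line[OF c x assms(2)] boundary_chart.gradient_nonzero[OF c x]
        interior_subset[of B] by (intro exI[of _ "gradient \<rho> x"]) blast
  next
    assume "x \<in> interior B"
    then obtain r where r: "r > 0" "ball x r \<subseteq> B" by (meson mem_interior)
    have "\<exists>e>0. \<forall>t. 0 < t \<and> t < e \<longrightarrow> x + t *\<^sub>R v \<in> B" for v
    proof (intro exI conjI allI impI)
      show "r / (norm v + 1) > 0" using r by (simp add: add_nonneg_pos)
      fix t assume t: "0 < t \<and> t < r / (norm v + 1)"
      then have "t * (norm v + 1) < r" by (simp add: pos_less_divide_eq add_nonneg_pos)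
      then have "t * norm v < r" using t by (simp add: algebra_simps)
      then show "x + t *\<^sub>R v \<in> B" using r t by (auto simp: dist_norm subset_iff)
    qed
    \<comment> \<open>In the interior every direction qualifies, so any nonzero vector may play the
      role of \<open>g\<close>.\<close>
    then show ?thesis by (intro exI[of _ "axis 1 1"]) (simp add: axis_eq_0_iff)
  qed
  then obtain g where g: "g \<noteq> 0" "\<And>v. v \<bullet> g < 0 \<Longrightarrow> \<exists>e>0. \<forall>t. 0 < t \<and> t < e \<longrightarrow> x + t *\<^sub>R v \<in> B" by blast
  have lin: "linear L" "linear M" using L M has_derivative_linear by auto
  have neg: "L v = M v" if v: "v \<bullet> g < 0" for v
  proof -
    obtain e where e: "e > 0" "\<And>t. \<lbrakk>0 < t; t < e\<rbrakk> \<Longrightarrow> x + t *\<^sub>R v \<in> B" using g(2)[OF v] by blast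
    have sub: "(\<lambda>t. x + t *\<^sub>R v) ` {0..e/2} \<subseteq> B"
    proof clarify
      fix t assume "t \<in> {0..e/2}"
      then show "x + t *\<^sub>R v \<in> B" using e assms(2) by (cases "t = 0") auto
    qed
    have dl: "((\<lambda>t. x + t *\<^sub>R v) has_derivative (\<lambda>h. h *\<^sub>R v)) (at 0 within {0..e/2})"
      by (auto intro!: derivative_eq_intros)
    have vd: "((\<lambda>t. f (x + t *\<^sub>R v)) has_vector_derivative N v) (at 0 within {0..e/2})"
      if N: "(f has_derivative N) (at x within B)" for N
    proof -
      have "(f has_derivative N) (at (x + 0 *\<^sub>R v) within (\<lambda>t. x + t *\<^sub>R v) ` {0..e/2})"
        using has_derivative_subset[OF N sub] by simp
      from has_derivative_in_compose[OF dl this]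
      show ?thesis unfolding has_vector_derivative_def
        by (rule has_derivative_eq_rhs) (simp add: fun_eq_iff linear_scale[OF has_derivative_linear[OF N]])
    qed
    show ?thesis
      by (rule vector_derivative_unique_within[OF _ vd[OF L] vd[OF M]])
         (use e(1) in \<open>simp add: at_within_Icc_at_right\<close>)
  qed
  show ?thesis
  proof
    fix w
    \<comment> \<open>Makes \<open>(w - k *\<^sub>R g) \<bullet> g\<close> equal to
      \<open>w \<bullet> g - \<bar>w \<bullet> g\<bar> - 1\<close>, which is negative.\<close>
    define k where "k = (\<bar>w \<bullet> g\<bar> + 1) / (g \<bullet> g)"
    have gg: "g \<bullet> g > 0" using g(1) by simp
    have k: "k > 0" "k * (g \<bullet> g) = \<bar>w \<bullet> g\<bar> + 1" using gg by (simp_all add: k_def add_nonneg_pos)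
    have "(w - k *\<^sub>R g) \<bullet> g < 0" using k by (simp add: inner_diff_left)
    then have 1: "L (w - k *\<^sub>R g) = M (w - k *\<^sub>R g)" by (rule neg)
    have "(- g) \<bullet> g < 0" using gg by simp
    then have "L (- g) = M (- g)" by (rule neg)
    then have "L g = M g" by (simp add: linear_neg lin)
    then show "L w = M w" using 1 by (simp add: linear_diff linear_scale lin)
  qed
qed

text \<open>Near a boundary point the body is connected by segments that descend into its interior.\<close>

lemma body_constant:
  fixes f :: "real^3 \<Rightarrow> 'b::real_inner"
  assumes "body B" and cont: "continuous_on B f"
    and zero: "\<And>x. x \<in> interior B \<Longrightarrow> (f has_derivative (\<lambda>h. 0)) (at x)"
    and xy: "x \<in> B" "y \<in> B"
  shows "f x = f y"
proof (rule connected_local_const[OF _ xy])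
  show "connected B" using assms by (simp add: body_def)
  have ball_const: "f a = f b" if "ball z r \<subseteq> interior B" "a \<in> ball z r" "b \<in> ball z r" for a b z r
    using has_derivative_zero_unique[OF convex_ball, of z r f, OF _ that(2,3)] zero that(1)
      has_derivative_at_withinI by blast
  show "\<forall>a\<in>B. \<forall>\<^sub>F b in at a within B. f a = f b"
  proof
    fix p assume p: "p \<in> B"
    have "\<exists>\<eta>>0. \<forall>b\<in>B. dist b p < \<eta> \<longrightarrow> f p = f b"
      using body_frontier_or_interior[OF assms(1) p]
    proof
      assume "p \<in> interior B"
      then obtain r where r: "r > 0" "ball p r \<subseteq> interior B" by (meson open_interior openE)
      then show ?thesis using ball_const[OF r(2), of p] by (intro exI[of _ r]) (auto simp: dist_commute)
    next
      assume pf: "p \<in> frontier B"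
      then obtain V \<rho> where c: "boundary_chart B V \<rho>" and pV: "p \<in> V"
        using body_boundary_chart[OF assms(1)] by metis
      interpret boundary_chart B V \<rho> by (rule c)
      define g where "g = gradient \<rho> p"
      have g0: "g \<bullet> g > 0" "norm g > 0" using gradient_nonzero[OF pV] by (simp_all add: g_def)
      have "continuous_on V (\<lambda>x. g \<bullet> gradient \<rho> x)" by (intro continuous_intros continuous_on_gradient)
      then have "open (V \<inter> (\<lambda>x. g \<bullet> gradient \<rho> x) -` {0<..})"
        using continuous_on_open_vimage[OF open_V] by (metis Int_commute open_greaterThan)
      moreover have "p \<in> V \<inter> (\<lambda>x. g \<bullet> gradient \<rho> x) -` {0<..}" using g0 pV by (simp add: g_def)
      ultimately obtain r where r: "r > 0" "ball p r \<subseteq> V \<inter> (\<lambda>x. g \<bullet> gradient \<rho> x) -` {0<..}"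
        by (meson openE)
      \<comment> \<open>A descent by \<open>\<delta> g\<close> covers half the radius, so points
        within \<open>r / 2\<close> of \<open>p\<close> stay in the ball where
        \<open>g \<bullet> gradient \<rho>\<close> is positive.\<close>
      define \<delta> where "\<delta> = r / (2 * norm g)"
      have \<delta>: "\<delta> > 0" "\<delta> * norm g = r / 2" using r g0 by (auto simp: \<delta>_def)
      have line: "x - t *\<^sub>R g \<in> ball p r" if "dist x p < r / 2" "0 \<le> t" "t \<le> \<delta>" for x t
      proof -
        have "dist (x - t *\<^sub>R g) p \<le> dist (x - t *\<^sub>R g) x + dist x p" by (rule dist_triangle)
        also have "dist (x - t *\<^sub>R g) x = t * norm g" using that by (simp add: dist_norm)
        also have "t * norm g \<le> r / 2" using that \<delta>(2) by (metis mult_right_mono norm_ge_zero)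
        finally show ?thesis using that(1) by (simp add: dist_commute)
      qed
      have int: "x - t *\<^sub>R g \<in> interior B" if "x \<in> B" "dist x p < r / 2" "0 < t" "t \<le> \<delta>" for x t
      proof -
        have inb: "x - s *\<^sub>R g \<in> V \<and> g \<bullet> gradient \<rho> (x - s *\<^sub>R g) > 0" if "0 \<le> s" "s \<le> t" for s
          using line[of x s] that r(2) \<open>dist x p < r / 2\<close> \<open>t \<le> \<delta>\<close> by auto
        have "((\<lambda>s. \<rho> (x - s *\<^sub>R g)) has_real_derivative - (g \<bullet> gradient \<rho> (x - s *\<^sub>R g))) (at s)"
          if "0 \<le> s" "s \<le> t" for s
        proof -
          have "((\<lambda>s. \<rho> (x - s *\<^sub>R g)) has_derivative (\<lambda>h. (- (h *\<^sub>R g)) \<bullet> gradient \<rho> (x - s *\<^sub>R g))) (at s)"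
            by (rule has_derivative_compose[where f = "\<lambda>s. x - s *\<^sub>R g" and g = \<rho>])
               (use GDERIV_\<rho> inb[OF that] in \<open>auto intro!: derivative_eq_intros simp: gderiv_def\<close>)
          then show ?thesis
            unfolding has_field_derivative_def by (rule has_derivative_eq_rhs) (simp add: fun_eq_iff)
        qed
        from MVT2[OF \<open>0 < t\<close> this] obtain s where s: "0 < s" "s < t"
          "\<rho> (x - t *\<^sub>R g) - \<rho> (x - 0 *\<^sub>R g) = (t - 0) * - (g \<bullet> gradient \<rho> (x - s *\<^sub>R g))" by blast
        have "t * (g \<bullet> gradient \<rho> (x - s *\<^sub>R g)) > 0" using inb[of s] s \<open>0 < t\<close> by simp
        then have "\<rho> (x - t *\<^sub>R g) < \<rho> x" using s(3) by simp
        moreover have "\<rho> x \<le> 0" using inb[of 0] \<open>0 < t\<close> \<open>x \<in> B\<close> B_Int_V by auto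
        ultimately show ?thesis using inb[of t] \<open>0 < t\<close> by (intro negative_imp_interior) auto
      qed
      have pint: "p - \<delta> *\<^sub>R g \<in> interior B" using int[of p \<delta>] p r \<delta> by simp
      then obtain \<eta> where \<eta>: "\<eta> > 0" "ball (p - \<delta> *\<^sub>R g) \<eta> \<subseteq> interior B" by (meson open_interior openE)
      \<comment> \<open>The derivative is known only in the interior, but \<open>x\<close> may lie
        on the boundary; continuity bridges the start of the segment.\<close>
      have push: "f x = f (x - \<delta> *\<^sub>R g)" if x: "x \<in> B" "dist x p < r / 2" for x
      proof -
        let ?h = "\<lambda>t. f (x - t *\<^sub>R g)"
        have inB: "x - t *\<^sub>R g \<in> B" if "0 \<le> t" "t \<le> \<delta>" for t
          using int[OF x, of t] x that interior_subset[of B] by (cases "t = 0") auto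
        have "continuous_on {0..\<delta>} ?h"
          by (rule continuous_on_compose2[OF cont]) (use inB in \<open>auto intro!: continuous_intros\<close>)
        moreover have "(?h has_derivative (\<lambda>h. 0)) (at t)" if "0 < t" "t < \<delta>" for t
        proof -
          have "((\<lambda>t. x - t *\<^sub>R g) has_derivative (\<lambda>h. - (h *\<^sub>R g))) (at t)"
            by (auto intro!: derivative_eq_intros)
          from has_derivative_compose[OF this zero[OF int[OF x]]] that show ?thesis by simp
        qed
        ultimately have "\<exists>\<xi>\<in>{0<..<\<delta>}. norm (?h \<delta> - ?h 0) \<le> norm (0::'b)"
          by (rule mvt_general[OF \<delta>(1)])
        then show ?thesis by simp
      qed
      show ?thesis
      proof (intro exI conjI ballI impI)
        show "min (r / 2) \<eta> > 0" using r \<eta> by simp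
        fix b assume b: "b \<in> B" "dist b p < min (r / 2) \<eta>"
        \<comment> \<open>Both points descend by the same vector into one ball of the interior,
          where \<open>f\<close> is constant.\<close>
        have "f p = f (p - \<delta> *\<^sub>R g)" using push p r by simp
        also have "\<dots> = f (b - \<delta> *\<^sub>R g)"
          using b \<eta>(1) by (intro ball_const[OF \<eta>(2)]) (auto simp: dist_norm norm_minus_commute)
        also have "\<dots> = f b" using push b by simp
        finally show "f p = f b" .
      qed
    qed
    then show "\<forall>\<^sub>F b in at p within B. f p = f b" by (auto simp: eventually_at)
  qed
qed

section \<open>Matrix calculus\<close>

text \<open>Jacobi's formula at the identity. It is enough because \<open>trace_derivative_F\<close>
  first normalises the gradient by its inverse at the point.\<close>

lemma has_derivative_det_3:
  fixes M :: "'a::real_normed_vector \<Rightarrow> real^3^3"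
  assumes M: "(M has_derivative M') (at x within S)" and "M x = mat 1"
  shows "((\<lambda>y. det (M y)) has_derivative (\<lambda>h. trace (M' h))) (at x within S)"
proof -
  have c: "((\<lambda>y. M y $ i $ j) has_derivative (\<lambda>h. M' h $ i $ j)) (at x within S)" for i j
    by (intro bounded_linear.has_derivative[OF bounded_linear_vec_nth] M)
  have i: "M x $ i $ j = (if i = j then 1 else 0)" for i j by (simp add: assms(2) mat_def)
  show ?thesis unfolding det_3
    by (auto intro!: derivative_eq_intros c simp: i trace_def sum_3)
qed

lemma linear_axis_expansion:
  assumes "linear (L :: real^'n \<Rightarrow> 'b::real_vector)"
  shows "L v = (\<Sum>i\<in>UNIV. v $ i *\<^sub>R L (axis i 1))"
proof -
  have "L v = L (\<Sum>i\<in>UNIV. v $ i *\<^sub>R axis i 1)"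
    by (simp add: basis_expansion scalar_mult_eq_scaleR[symmetric])
  then show ?thesis by (simp add: linear_sum[OF assms] linear_scale[OF assms])
qed

text \<open>The algebra of the Piola transformation: \<open>L (Ai *v axis b 1)\<close> is the
  spatial derivative of a referential field, and the factor \<open>transpose A\<close> cancels
  \<open>Ai\<close>, which leaves the referential divergence.\<close>

lemma sum_divergence_change_of_variables:
  fixes A :: "real^'n^'n" and L :: "real^'n \<Rightarrow> real^'n^'m"
  assumes L: "linear L" and A: "Ai ** A = mat 1"
  shows "(\<Sum>b\<in>UNIV. (L (Ai *v axis b 1) ** transpose A) $ a $ b) = (\<Sum>j\<in>UNIV. L (axis j 1) $ a $ j)"
proof -
  have "(L (Ai *v axis b 1) ** transpose A) $ a $ b
      = (\<Sum>j\<in>UNIV. \<Sum>k\<in>UNIV. L (axis j 1) $ a $ k * (Ai $ j $ b * A $ b $ k))" for b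
  proof -
    have "L (Ai *v axis b 1) = (\<Sum>j\<in>UNIV. Ai $ j $ b *\<^sub>R L (axis j 1))"
      by (subst linear_axis_expansion[OF L]) (simp add: matrix_vector_mult_basis column_def)
    then have "(L (Ai *v axis b 1) ** transpose A) $ a $ b
        = (\<Sum>k\<in>UNIV. \<Sum>j\<in>UNIV. L (axis j 1) $ a $ k * (Ai $ j $ b * A $ b $ k))"
      by (simp add: matrix_matrix_mult_def transpose_def sum_distrib_left sum_distrib_right mult_ac)
    then show ?thesis by (subst sum.swap) simp
  qed
  then have "(\<Sum>b\<in>UNIV. (L (Ai *v axis b 1) ** transpose A) $ a $ b)
      = (\<Sum>b\<in>UNIV. \<Sum>j\<in>UNIV. \<Sum>k\<in>UNIV. L (axis j 1) $ a $ k * (Ai $ j $ b * A $ b $ k))" by simp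
  also have "\<dots> = (\<Sum>j\<in>UNIV. \<Sum>b\<in>UNIV. \<Sum>k\<in>UNIV. L (axis j 1) $ a $ k * (Ai $ j $ b * A $ b $ k))"
    by (rule sum.swap)
  also have "\<dots> = (\<Sum>j\<in>UNIV. \<Sum>k\<in>UNIV. \<Sum>b\<in>UNIV. L (axis j 1) $ a $ k * (Ai $ j $ b * A $ b $ k))"
    by (intro sum.cong refl sum.swap)
  also have "\<dots> = (\<Sum>j\<in>UNIV. \<Sum>k\<in>UNIV. L (axis j 1) $ a $ k * (Ai ** A) $ j $ k)"
    by (simp add: matrix_matrix_mult_def sum_distrib_left)
  also have "\<dots> = (\<Sum>j\<in>UNIV. L (axis j 1) $ a $ j)"
    by (simp add: A mat_def if_distrib cong: if_cong)
  finally show ?thesis .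
qed

lemma bounded_bilinear_matrix_matrix_mult:
  "bounded_bilinear ((**) :: real^'n^'m \<Rightarrow> real^'k^'n \<Rightarrow> real^'k^'m)"
proof -
  have "bilinear ((**) :: real^'n^'m \<Rightarrow> real^'k^'n \<Rightarrow> real^'k^'m)"
    unfolding bilinear_def
    by (auto intro!: linearI
        simp: matrix_matrix_mult_def vec_eq_iff sum_distrib_left algebra_simps sum.distrib)
  then show ?thesis using bilinear_conv_bounded_bilinear by blast
qed

lemma bounded_bilinear_matrix_vector_mult:
  "bounded_bilinear ((*v) :: real^'n^'m \<Rightarrow> real^'n \<Rightarrow> real^'m)"
proof -
  have "bilinear ((*v) :: real^'n^'m \<Rightarrow> real^'n \<Rightarrow> real^'m)"
    unfolding bilinear_def
    by (auto intro!: linearI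
        simp: matrix_vector_mult_def vec_eq_iff sum_distrib_left algebra_simps sum.distrib)
  then show ?thesis using bilinear_conv_bounded_bilinear by blast
qed

lemma bounded_linear_transpose: "bounded_linear (transpose :: real^'n^'m \<Rightarrow> real^'m^'n)"
  by (intro linear_conv_bounded_linear[THEN iffD1] linearI)
     (simp_all add: transpose_def vec_eq_iff)

lemmas has_derivative_matrix_mult =
  bounded_bilinear.FDERIV[OF bounded_bilinear_matrix_matrix_mult]

lemmas has_derivative_transpose = bounded_linear.has_derivative[OF bounded_linear_transpose]

lemma smooth_on_has_derivative:
  assumes "smooth_on A f" "x \<in> A" obtains f' where "(f has_derivative f') (at x within A)"
proof -
  obtain U g where U: "open U" "x \<in> U" "\<And>n. Cn_on n U g" "\<And>y. y \<in> U \<inter> A \<Longrightarrow> g y = f y"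
    by (rule smooth_onE[OF assms]) (rule that)
  show thesis
    by (rule that[OF has_derivative_within_local_extension[OF U(1,2) assms(2) U(4)
          Cn_on_Suc_has_derivative[OF U(3,2)]]])
qed

section \<open>Universal deformations\<close>

locale body_deformation =
  fixes B :: "(real^3) set" and \<phi> :: "real^3 \<Rightarrow> real^3"
  assumes body: "body B" and deformation: "deformation B \<phi>"
begin

abbreviation "F \<equiv> deformation_gradient B \<phi>"

definition Fi :: "real^3 \<Rightarrow> real^3^3" where "Fi X = matrix_inv (F X)"

text \<open>Indexed by the reference point, unlike \<open>b_field\<close>, because derivatives
  relative to \<open>B\<close> are known to be unique.\<close>

definition b :: "real^3 \<Rightarrow> real^3^3" where "b X = F X ** transpose (F X)"

lemmas derivative_unique = body_has_derivative_unique[OF body]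

lemma inv_into_\<phi>: "X \<in> B \<Longrightarrow> inv_into B \<phi> (\<phi> X) = X"
  using deformation by (simp add: deformation_def)

lemma \<phi>_has_derivative:
  assumes "X \<in> B" shows "(\<phi> has_derivative (\<lambda>h. F X *v h)) (at X within B)"
proof -
  obtain f' where "(\<phi> has_derivative f') (at X within B)"
    using smooth_on_has_derivative deformation assms unfolding deformation_def by metis
  then have "\<phi> differentiable (at X within B)" by (auto simp: differentiable_def)
  then show ?thesis by (simp add: jacobian_works deformation_gradient_def)
qed

text \<open>The chain rule for the smooth inverse gives a left inverse of \<open>F X\<close>; at
  boundary points this relies on uniqueness of derivatives relative to the body.\<close>

lemma Fi_F:
  assumes "X \<in> B" shows "Fi X ** F X = mat 1" "F X ** Fi X = mat 1"
proof -
  have "smooth_on (\<phi> ` B) (inv_into B \<phi>)" "\<phi> X \<in> \<phi> ` B"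
    using deformation assms by (auto simp: deformation_def)
  then obtain G where G: "(inv_into B \<phi> has_derivative G) (at (\<phi> X) within \<phi> ` B)"
    by (rule smooth_on_has_derivative)
  have "((\<lambda>Y. inv_into B \<phi> (\<phi> Y)) has_derivative (\<lambda>h. G (F X *v h))) (at X within B)"
    by (rule has_derivative_in_compose[OF \<phi>_has_derivative[OF assms] G])
  moreover have "((\<lambda>Y. inv_into B \<phi> (\<phi> Y)) has_derivative (\<lambda>h. h)) (at X within B)"
    by (rule has_derivative_transform[OF assms _ has_derivative_ident]) (simp add: inv_into_\<phi>)
  ultimately have "(\<lambda>h. G (F X *v h)) = (\<lambda>h. h)" by (rule derivative_unique[OF assms])
  then have "inj ((*v) (F X))" by (metis injI)
  then have "invertible (F X)"
    using invertible_left_inverse matrix_left_invertible_injective by blast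
  then have "\<exists>A'. F X ** A' = mat 1 \<and> A' ** F X = mat 1" by (simp add: invertible_def)
  from someI_ex[OF this] show "Fi X ** F X = mat 1" "F X ** Fi X = mat 1"
    by (simp_all add: Fi_def matrix_inv_def)
qed

lemma Fi_F_vec: "X \<in> B \<Longrightarrow> Fi X *v (F X *v h) = h" "X \<in> B \<Longrightarrow> F X *v (Fi X *v h) = h"
  by (simp_all add: matrix_vector_mul_assoc Fi_F)

text \<open>\<open>F\<close> is defined by derivatives relative to \<open>B\<close>. Expressing it
  by an extension that is \<open>Cn_on\<close> for all \<open>n\<close> gives access to its higher
  derivatives.\<close>

lemma local_extension:
  assumes "X \<in> B"
  obtains U g where "open U" "X \<in> U" "\<And>n. Cn_on n U g" "\<And>Y. Y \<in> U \<inter> B \<Longrightarrow> g Y = \<phi> Y"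
    "\<And>Y. Y \<in> U \<inter> B \<Longrightarrow> F Y = (\<chi> a j. dir_deriv (axis j 1) g Y $ a)"
proof -
  have "smooth_on B \<phi>" using deformation by (simp add: deformation_def)
  from smooth_onE[OF this assms] obtain U g where
    U: "open U" "X \<in> U" "\<And>n. Cn_on n U g" "\<And>Y. Y \<in> U \<inter> B \<Longrightarrow> g Y = \<phi> Y" by metis
  have "F Y = (\<chi> a j. dir_deriv (axis j 1) g Y $ a)" if Y: "Y \<in> U \<inter> B" for Y
  proof -
    have "(\<phi> has_derivative (\<lambda>v. dir_deriv v g Y)) (at Y within B)"
      using Y by (intro has_derivative_within_local_extension[OF U(1) _ _ U(4) Cn_on_Suc_has_derivative[OF U(3)]]) auto
    from derivative_unique[OF _ \<phi>_has_derivative this] Y have "F Y *v h = dir_deriv h g Y" for h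
      by (metis IntD2)
    from this[symmetric] show ?thesis by (simp add: vec_eq_iff matrix_vector_mult_basis column_def)
  qed
  with U show thesis by (intro that[of U g]) auto
qed

lemma F_has_derivative:
  assumes "X \<in> B" obtains F' where "(F has_derivative F') (at X within B)"
proof -
  obtain U g where U: "open U" "X \<in> U" "\<And>n. Cn_on n U g" "\<And>Y. Y \<in> U \<inter> B \<Longrightarrow> g Y = \<phi> Y"
    "\<And>Y. Y \<in> U \<inter> B \<Longrightarrow> F Y = (\<chi> a j. dir_deriv (axis j 1) g Y $ a)"
    by (rule local_extension[OF assms]) (rule that)
  have "((\<lambda>Y. \<chi> a j. dir_deriv (axis j 1) g Y $ a) has_derivative
      (\<lambda>h. \<chi> a j. dir_deriv h (dir_deriv (axis j 1) g) X $ a)) (at X)"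
    by (intro has_derivative_vec; simp)
       (intro bounded_linear.has_derivative[OF bounded_linear_vec_nth]
        Cn_on_Suc_has_derivative[OF Cn_on_Suc_dir_deriv[OF U(3)] U(2)])
  from has_derivative_within_local_extension[OF U(1,2) assms U(5)[symmetric] this]
  show thesis by (rule that)
qed

lemma continuous_on_F: "continuous_on B F"
  unfolding continuous_on_eq_continuous_within
  using F_has_derivative has_derivative_continuous by metis

end

section \<open>Consequences of equilibrium for a single response function\<close>

locale universal = body_deformation +
  fixes S :: "real^3 \<Rightarrow> real^3^3"
  assumes universal: "universal_pair B \<phi> S"
begin

definition s :: "real^3 \<Rightarrow> real^3^3" where "s X = F X ** S X ** transpose (F X)"

text \<open>Equilibrium stated on \<open>B\<close>: \<open>R' (Fi X *v axis j 1)\<close> is the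
  spatial derivative of the stress along \<open>axis j 1\<close>. Differentiability of the stress is
  part of \<open>has_divergence\<close> and need not be derived.\<close>

lemma universal_divergence:
  assumes X: "X \<in> B" and k: "k \<le> 7" "smooth_on attainable_invariants f"
  obtains R' where
    "((\<lambda>Y. stress_response (\<lambda>i. if i = k then f else (\<lambda>_. 0)) (b Y) (s Y)) has_derivative R') (at X within B)"
    "\<And>a. (\<Sum>j\<in>UNIV. R' (Fi X *v axis j 1) $ a $ j) = 0"
proof -
  let ?\<alpha> = "\<lambda>i. if i = k then f else (\<lambda>_. 0)"
  have "response_functions ?\<alpha>" using k by (auto simp: response_functions_def smooth_on_const)
  then have "has_divergence (cauchy_stress ?\<alpha> B \<phi> S) 0 (\<phi> X) (\<phi> ` B)"
    using universal X unfolding universal_pair_def by blast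
  then obtain T' where T: "(cauchy_stress ?\<alpha> B \<phi> S has_derivative T') (at (\<phi> X) within \<phi> ` B)"
    and div: "0 = (\<chi> a. \<Sum>j\<in>UNIV. T' (axis j 1) $ a $ j)"
    unfolding has_divergence_def by blast
  have "((\<lambda>Y. cauchy_stress ?\<alpha> B \<phi> S (\<phi> Y)) has_derivative (\<lambda>h. T' (F X *v h))) (at X within B)"
    by (rule has_derivative_in_compose[OF \<phi>_has_derivative[OF X] T])
  then have "((\<lambda>Y. stress_response ?\<alpha> (b Y) (s Y)) has_derivative (\<lambda>h. T' (F X *v h))) (at X within B)"
    by (rule has_derivative_transform[OF X, rotated])
       (simp add: cauchy_stress_def b_field_def pushed_residual_stress_def inv_into_\<phi> b_def s_def Let_def)
  then show thesis
  proof (rule that)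
    show "(\<Sum>j\<in>UNIV. T' (F X *v (Fi X *v axis j 1)) $ a $ j) = 0" for a
      using arg_cong[OF div, of "\<lambda>v. v $ a"] by (simp add: Fi_F_vec[OF X])
  qed
qed

text \<open>If only \<open>\<alpha> 0 = f\<close> is nonzero, the stress is spherical and its
  divergence is the spatial gradient of the scalar \<open>f\<close> of the invariants.\<close>

lemma invariant_derivative_zero:
  fixes f :: "real10 \<Rightarrow> real"
  assumes X: "X \<in> B" and f: "bounded_linear f"
  shows "((\<lambda>Y. f (invariants (b Y) (s Y))) has_derivative (\<lambda>h. 0)) (at X within B)"
proof -
  let ?q = "\<lambda>Y. f (invariants (b Y) (s Y))"
  obtain R' where R0: "((\<lambda>Y. stress_response (\<lambda>i. if i = 0 then f else (\<lambda>_. 0)) (b Y) (s Y)) has_derivative R') (at X within B)"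
    and div: "\<And>a. (\<Sum>j\<in>UNIV. R' (Fi X *v axis j 1) $ a $ j) = 0"
    using universal_divergence[OF X _ smooth_on_bounded_linear[OF f], of 0] by auto
  from R0 have R: "((\<lambda>Y. ?q Y *\<^sub>R mat 1 :: real^3^3) has_derivative R') (at X within B)"
    by (simp add: stress_response_def Let_def)
  have comp: "((\<lambda>Y. ?q Y * (if i = j then 1 else 0)) has_derivative (\<lambda>h. R' h $ i $ j)) (at X within B)" for i j :: 3
    using bounded_linear.has_derivative[OF bounded_linear_vec_nth
        bounded_linear.has_derivative[OF bounded_linear_vec_nth R, of i], of j]
    by (simp add: mat_def)
  \<comment> \<open>The derivative of a spherical field is spherical; this is read off entrywise by
    uniqueness of derivatives.\<close>
  have off: "R' h $ i $ j = 0" if "i \<noteq> j" for h i j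
    using derivative_unique[OF X comp[of i j], of "\<lambda>h. 0"] that by (simp add: fun_eq_iff)
  have diag: "R' h $ i $ i = R' h $ j $ j" for h i j
    using derivative_unique[OF X comp[of i i], of "\<lambda>h. R' h $ j $ j"] comp[of j j]
    by (simp add: fun_eq_iff)
  have q: "(?q has_derivative (\<lambda>h. R' h $ 1 $ 1)) (at X within B)" using comp[of 1 1] by simp
  have lin: "linear (\<lambda>h. R' h $ 1 $ 1)" by (rule has_derivative_linear[OF q])
  have ax: "R' (Fi X *v axis a 1) $ 1 $ 1 = 0" for a
  proof -
    have "(\<Sum>j\<in>UNIV. R' (Fi X *v axis j 1) $ a $ j) = (\<Sum>j\<in>UNIV. if j = a then R' (Fi X *v axis a 1) $ a $ a else 0)"
      by (intro sum.cong) (auto simp: off)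
    then show ?thesis using div[of a] diag[of _ 1 a] by simp
  qed
  have "R' h $ 1 $ 1 = 0" for h
  proof -
    have l: "linear (\<lambda>k. R' (Fi X *v k) $ 1 $ 1)"
      using linear_compose[OF matrix_vector_mul_linear[of "Fi X"] lin] by (simp add: o_def)
    \<comment> \<open>The vectors \<open>Fi X *v axis a 1\<close> span, so every \<open>h\<close> is
      reached through \<open>F X *v h\<close>.\<close>
    have "R' (Fi X *v (F X *v h)) $ 1 $ 1 = 0"
      by (subst linear_axis_expansion[OF l]) (simp add: ax)
    then show ?thesis by (simp add: Fi_F_vec[OF X])
  qed
  with q show ?thesis by simp
qed

lemma trace_b_derivative_zero:
  assumes "X \<in> B" shows "((\<lambda>Y. trace (b Y)) has_derivative (\<lambda>h. 0)) (at X within B)"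
  using invariant_derivative_zero[OF assms bounded_linear_fst] by (simp add: invariants_def)

lemma det_b_derivative_zero:
  assumes "X \<in> B" shows "((\<lambda>Y. det (b Y)) has_derivative (\<lambda>h. 0)) (at X within B)"
proof -
  have "bounded_linear (\<lambda>I::real10. fst (snd (snd I)))"
    by (intro bounded_linear_compose[OF bounded_linear_fst] bounded_linear_compose[OF bounded_linear_snd]
        bounded_linear_snd)
  from invariant_derivative_zero[OF assms this] show ?thesis by (simp add: invariants_def)
qed

lemma trace_s2_derivative_zero:
  assumes "X \<in> B" shows "((\<lambda>Y. trace (s Y ** s Y)) has_derivative (\<lambda>h. 0)) (at X within B)"
proof -
  have "bounded_linear (\<lambda>I::real10. fst (snd (snd (snd (snd I)))))"
    by (intro bounded_linear_compose[OF bounded_linear_fst] bounded_linear_compose[OF bounded_linear_snd]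
        bounded_linear_snd)
  from invariant_derivative_zero[OF assms this] show ?thesis by (simp add: invariants_def)
qed

lemma divergence_b:
  assumes "X \<in> B" "(b has_derivative b') (at X within B)"
  shows "(\<Sum>j\<in>UNIV. b' (Fi X *v axis j 1) $ a $ j) = 0"
proof -
  obtain R' where R: "((\<lambda>Y. stress_response (\<lambda>i. if i = 1 then (\<lambda>_. 1) else (\<lambda>_. 0)) (b Y) (s Y)) has_derivative R') (at X within B)"
    and div: "\<And>a. (\<Sum>j\<in>UNIV. R' (Fi X *v axis j 1) $ a $ j) = 0"
    by (rule universal_divergence[OF assms(1) _ smooth_on_const, of 1 1]) auto
  from R have "(b has_derivative R') (at X within B)" by (simp add: stress_response_def Let_def)
  from derivative_unique[OF assms(1) assms(2) this] div show ?thesis by simp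
qed

lemma divergence_s2:
  assumes "X \<in> B" "((\<lambda>Y. s Y ** s Y) has_derivative T') (at X within B)"
  shows "(\<Sum>j\<in>UNIV. T' (Fi X *v axis j 1) $ a $ j) = 0"
proof -
  obtain R' where R: "((\<lambda>Y. stress_response (\<lambda>i. if i = 4 then (\<lambda>_. 1) else (\<lambda>_. 0)) (b Y) (s Y)) has_derivative R') (at X within B)"
    and div: "\<And>a. (\<Sum>j\<in>UNIV. R' (Fi X *v axis j 1) $ a $ j) = 0"
    by (rule universal_divergence[OF assms(1) _ smooth_on_const, of 4 1]) auto
  from R have "((\<lambda>Y. s Y ** s Y) has_derivative R') (at X within B)"
    by (simp add: stress_response_def Let_def)
  from derivative_unique[OF assms(1) assms(2) this] div show ?thesis by simp
qed

text \<open>The trace is the logarithmic derivative of \<open>det F\<close>, which vanishes because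
  \<open>det b\<close> is the square of \<open>det F\<close>.\<close>

lemma trace_derivative_F:
  assumes X: "X \<in> B" and F': "(F has_derivative F') (at X within B)"
  shows "trace (F' h ** Fi X) = 0"
proof -
  have det0: "det (F X) \<noteq> 0"
    using Fi_F(1)[OF X] det_mul[of "Fi X" "F X"] by auto
  have "((\<lambda>Y. F Y ** Fi X) has_derivative (\<lambda>h. F' h ** Fi X)) (at X within B)"
    by (rule bounded_linear.has_derivative[OF bounded_bilinear.bounded_linear_left[OF bounded_bilinear_matrix_matrix_mult] F'])
  from has_derivative_det_3[OF this Fi_F(2)[OF X]]
  have d: "((\<lambda>Y. det (F Y ** Fi X)) has_derivative (\<lambda>h. trace (F' h ** Fi X))) (at X within B)" .
  have e: "det (F Y ** Fi X) ^ 2 = det (b Y) * det (Fi X) ^ 2" for Y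
    by (simp add: b_def det_mul power2_eq_square mult_ac)
  have 1: "((\<lambda>Y. det (F Y ** Fi X) ^ 2) has_derivative (\<lambda>h. 2 * trace (F' h ** Fi X))) (at X within B)"
    by (rule has_derivative_eq_rhs[OF has_derivative_power[OF d, of 2]]) (simp add: Fi_F(2)[OF X])
  have 2: "((\<lambda>Y. det (F Y ** Fi X) ^ 2) has_derivative (\<lambda>h. 0)) (at X within B)"
    unfolding e using has_derivative_mult_left[OF det_b_derivative_zero[OF X], of "det (Fi X) ^ 2"] by simp
  from derivative_unique[OF X 1 2] show ?thesis by (metis mult_eq_0_iff zero_neq_numeral)
qed

lemma F_derivative_zero:
  assumes X: "X \<in> interior B" shows "(F has_derivative (\<lambda>h. 0)) (at X)"
proof -
  have XB: "X \<in> B" using X interior_subset by blast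
  obtain U g where U: "open U" "X \<in> U" "\<And>n. Cn_on n U g" "\<And>Y. Y \<in> U \<inter> B \<Longrightarrow> g Y = \<phi> Y"
    "\<And>Y. Y \<in> U \<inter> B \<Longrightarrow> F Y = (\<chi> a j. dir_deriv (axis j 1) g Y $ a)"
    by (rule local_extension[OF XB]) (rule that)
  define W where "W = U \<inter> interior B"
  have W: "open W" "X \<in> W" "W \<subseteq> U" "W \<subseteq> B" "W \<subseteq> U \<inter> B"
    using U X interior_subset[of B] by (auto simp: W_def open_Int)
  have Cg: "Cn_on n W g" for n by (rule Cn_on_subset[OF U(3) W(3)])
  define D :: "3 \<Rightarrow> (real^3 \<Rightarrow> real^3) \<Rightarrow> real^3 \<Rightarrow> real^3"
    where "D j f = dir_deriv (axis j 1) f" for j f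
  have Dd: "dir_deriv (axis j 1) f = D j f" for j and f :: "real^3 \<Rightarrow> real^3" by (simp add: D_def)
  have CD: "Cn_on n W f \<Longrightarrow> Cn_on (n - 1) W (D j f)" if "n > 0" for n j f
    using that Cn_on_Suc_dir_deriv[of "n - 1" W f] by (simp add: D_def)
  have C1: "Cn_on n W (D j g)" for n j using CD[of "Suc n" g j] Cg by simp
  have C2: "Cn_on n W (D k (D j g))" for n j k using CD[of "Suc n" "D j g" k] C1 by simp
  have at_B: "at Y within B = at Y" if "Y \<in> W" for Y
    using that W(1,4) by (metis at_within_interior interior_maximal subsetD W_def IntD2)
  have dF: "(F has_derivative (\<lambda>h. \<chi> a j. dir_deriv h (D j g) Y $ a)) (at Y)" if Y: "Y \<in> W" for Y
  proof (rule has_derivative_transform_within_open[OF _ W(1) Y])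
    show "((\<lambda>Y. \<chi> a j. D j g Y $ a) has_derivative (\<lambda>h. \<chi> a j. dir_deriv h (D j g) Y $ a)) (at Y)"
      by (intro has_derivative_vec; simp)
         (intro bounded_linear.has_derivative[OF bounded_linear_vec_nth] Cn_on_Suc_has_derivative[OF C1 Y])
    show "(\<chi> a j. D j g Z $ a) = F Z" if "Z \<in> W" for Z
      unfolding D_def by (rule U(5)[symmetric]) (use W(5) that in blast)
  qed
  have dDg: "(D j g has_derivative (\<lambda>h. dir_deriv h (D j g) Y)) (at Y)" if "Y \<in> W" for j Y
    by (rule Cn_on_Suc_has_derivative[OF C1 that])
  have dDDg: "(D k (D j g) has_derivative (\<lambda>h. dir_deriv h (D k (D j g)) Y)) (at Y)" if "Y \<in> W" for j k Y
    by (rule Cn_on_Suc_has_derivative[OF C2 that])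
  have comm: "D j (D k g) Y = D k (D j g) Y" if "Y \<in> W" for j k Y
    unfolding D_def by (rule dir_deriv_commute[OF W(1) that Cg])
  \<comment> \<open>The product rule splits the divergence of \<open>b\<close>. Where
    \<open>transpose F\<close> is differentiated, symmetry of second derivatives produces the traces
    of \<open>trace_derivative_F\<close>, which vanish; where \<open>F\<close> is differentiated,
    the Laplacian appears.\<close>
  have harmonic: "(\<Sum>j\<in>UNIV. D j (D j g) Y) = 0" if Y: "Y \<in> W" for Y
  proof -
    have YB: "Y \<in> B" using Y W by blast
    define F' where "F' h = (\<chi> a j. dir_deriv h (D j g) Y $ a)" for h
    have F': "(F has_derivative F') (at Y within B)"
      using dF[OF Y] by (simp add: at_B[OF Y] F'_def[abs_def])
    have linF': "linear F'" using F' has_derivative_linear by blast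
    have sym: "F' (axis A 1) *v h = (\<chi> c. F' h $ c $ A)" for A h
    proof -
      have "F' (axis A 1) *v h = (\<Sum>i\<in>UNIV. h $ i *\<^sub>R (F' (axis A 1) *v axis i 1))"
        by (rule linear_axis_expansion) simp
      also have "\<dots> = (\<Sum>i\<in>UNIV. h $ i *\<^sub>R D A (D i g) Y)"
        by (simp add: F'_def Dd matrix_vector_mult_basis column_def)
      also have "\<dots> = (\<Sum>i\<in>UNIV. h $ i *\<^sub>R dir_deriv (axis i 1) (D A g) Y)"
        by (simp add: comm[OF Y, of A] Dd)
      also have "\<dots> = dir_deriv h (D A g) Y"
        by (rule linear_axis_expansion[symmetric, OF has_derivative_linear[OF dDg[OF Y]]])
      finally show ?thesis by (simp add: F'_def vec_eq_iff)
    qed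
    define L where "L h = F' h ** transpose (F Y)" for h
    have b': "(b has_derivative (\<lambda>h. F Y ** transpose (F' h) + F' h ** transpose (F Y))) (at Y within B)"
      unfolding b_def[abs_def] by (rule has_derivative_matrix_mult[OF F' has_derivative_transpose[OF F']])
    have "(\<Sum>j\<in>UNIV. D j (D j g) Y) $ a = 0" for a
    proof -
      have "(F Y ** transpose (F' (Fi Y *v axis j 1))) $ a $ j = (\<Sum>A\<in>UNIV. F Y $ a $ A * (F' (axis A 1) ** Fi Y) $ j $ j)" for j
      proof -
        have "(F' (axis A 1) ** Fi Y) $ j $ j = F' (Fi Y *v axis j 1) $ j $ A" for A
        proof -
          have "(F' (axis A 1) ** Fi Y) $ j $ j = ((F' (axis A 1) ** Fi Y) *v axis j 1) $ j"
            by (simp add: matrix_vector_mult_basis column_def)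
          also have "\<dots> = (F' (axis A 1) *v (Fi Y *v axis j 1)) $ j"
            by (simp only: matrix_vector_mul_assoc)
          finally show ?thesis by (simp only: sym) simp
        qed
        then show ?thesis by (simp add: matrix_matrix_mult_def[of "F Y"] transpose_def)
      qed
      then have "(\<Sum>j\<in>UNIV. (F Y ** transpose (F' (Fi Y *v axis j 1))) $ a $ j)
          = (\<Sum>j\<in>UNIV. \<Sum>A\<in>UNIV. F Y $ a $ A * (F' (axis A 1) ** Fi Y) $ j $ j)" by simp
      also have "\<dots> = (\<Sum>A\<in>UNIV. F Y $ a $ A * trace (F' (axis A 1) ** Fi Y))"
        by (subst sum.swap) (simp add: trace_def sum_distrib_left)
      also have "\<dots> = 0" by (simp add: trace_derivative_F[OF YB F'])
      finally have 1: "(\<Sum>j\<in>UNIV. (F Y ** transpose (F' (Fi Y *v axis j 1))) $ a $ j) = 0" .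
      have "(\<Sum>j\<in>UNIV. (F' (Fi Y *v axis j 1) ** transpose (F Y)) $ a $ j) = 0"
        using divergence_b[OF YB b', of a] 1 by (simp add: sum.distrib)
      then have "(\<Sum>j\<in>UNIV. F' (axis j 1) $ a $ j) = 0"
        by (simp add: sum_divergence_change_of_variables[OF linF' Fi_F(1)[OF YB]])
      then show ?thesis by (simp add: F'_def Dd)
    qed
    then show ?thesis by (simp add: vec_eq_iff)
  qed
  have trb: "trace (b Y) = (\<Sum>j\<in>UNIV. D j g Y \<bullet> D j g Y)" if "Y \<in> W" for Y
  proof -
    have "F Y = (\<chi> a j. D j g Y $ a)" using U(5) W(5) that by (auto simp: D_def)
    then have "trace (b Y) = (\<Sum>a\<in>UNIV. \<Sum>j\<in>UNIV. D j g Y $ a * D j g Y $ a)"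
      by (simp add: b_def trace_def matrix_matrix_mult_def transpose_def)
    then show ?thesis by (subst (asm) sum.swap) (simp add: inner_vec_def)
  qed
  have first: "(\<Sum>j\<in>UNIV. D j g Y \<bullet> D k (D j g) Y) = 0" if Y: "Y \<in> W" for Y k
  proof -
    have d1: "((\<lambda>Y. \<Sum>j\<in>UNIV. D j g Y \<bullet> D j g Y) has_derivative
        (\<lambda>h. \<Sum>j\<in>UNIV. D j g Y \<bullet> dir_deriv h (D j g) Y + dir_deriv h (D j g) Y \<bullet> D j g Y)) (at Y)"
      by (intro has_derivative_sum has_derivative_inner dDg[OF Y])
    have d2: "((\<lambda>Y. \<Sum>j\<in>UNIV. D j g Y \<bullet> D j g Y) has_derivative (\<lambda>h. 0)) (at Y)"
      by (rule has_derivative_transform_within_open[OF _ W(1) Y trb])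
         (use trace_b_derivative_zero[of Y] Y W(4) in \<open>auto simp: at_B\<close>)
    show ?thesis
      using fun_cong[OF has_derivative_unique[OF d1 d2], of "axis k 1"]
      by (simp add: Dd inner_commute sum.distrib sum_distrib_left[symmetric])
  qed
  \<comment> \<open>After commuting, this is a derivative of the Laplacian of \<open>g\<close>,
    which vanishes on the whole neighbourhood \<open>W\<close>.\<close>
  have third: "(\<Sum>k\<in>UNIV. D k (D k (D j g)) X) = 0" for j
  proof -
    have "D k (D k (D j g)) X = D j (D k (D k g)) X" for k
    proof -
      have "(D k (D j g) has_derivative (\<lambda>h. dir_deriv h (D j (D k g)) X)) (at X)"
        by (rule has_derivative_transform_within_open[OF dDDg[OF W(2)] W(1,2)]) (rule comm)
      then have "D k (D k (D j g)) X = D k (D j (D k g)) X"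
        using has_derivative_imp_dir_deriv by (metis D_def)
      also have "\<dots> = D j (D k (D k g)) X"
        unfolding D_def by (rule dir_deriv_commute[OF W(1,2) C1[unfolded D_def]])
      finally show ?thesis .
    qed
    then have "(\<Sum>k\<in>UNIV. D k (D k (D j g)) X) = (\<Sum>k\<in>UNIV. D j (D k (D k g)) X)" by simp
    moreover have "((\<lambda>Y. \<Sum>k\<in>UNIV. D k (D k g) Y) has_derivative (\<lambda>h. \<Sum>k\<in>UNIV. dir_deriv h (D k (D k g)) X)) (at X)"
      by (intro has_derivative_sum dDDg W)
    then have "((\<lambda>Y. 0) has_derivative (\<lambda>h. \<Sum>k\<in>UNIV. dir_deriv h (D k (D k g)) X)) (at X)"
      by (rule has_derivative_transform_within_open[OF _ W(1,2) harmonic])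
    from fun_cong[OF has_derivative_unique[OF this has_derivative_const], of "axis j 1"]
    have "(\<Sum>k\<in>UNIV. D j (D k (D k g)) X) = 0" by (simp add: Dd)
    ultimately show ?thesis by simp
  qed
  have second: "(\<Sum>j\<in>UNIV. D k (D j g) X \<bullet> D k (D j g) X + D j g X \<bullet> D k (D k (D j g)) X) = 0" for k
  proof -
    have "((\<lambda>Y. \<Sum>j\<in>UNIV. D j g Y \<bullet> D k (D j g) Y) has_derivative
        (\<lambda>h. \<Sum>j\<in>UNIV. D j g X \<bullet> dir_deriv h (D k (D j g)) X + dir_deriv h (D j g) X \<bullet> D k (D j g) X)) (at X)"
      by (intro has_derivative_sum has_derivative_inner dDg dDDg W)
    then have "((\<lambda>Y. 0) has_derivative
        (\<lambda>h. \<Sum>j\<in>UNIV. D j g X \<bullet> dir_deriv h (D k (D j g)) X + dir_deriv h (D j g) X \<bullet> D k (D j g) X)) (at X)"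
      by (rule has_derivative_transform_within_open[OF _ W(1,2) first])
    from fun_cong[OF has_derivative_unique[OF this has_derivative_const], of "axis k 1"]
    show ?thesis by (simp add: Dd add.commute)
  qed
  \<comment> \<open>Summing \<open>second\<close> over \<open>k\<close> brings in the Laplacians of
    \<open>D j g\<close>; they vanish and leave a sum of squares.\<close>
  have "(\<Sum>k\<in>UNIV. \<Sum>j\<in>UNIV. D j g X \<bullet> D k (D k (D j g)) X) = (\<Sum>j\<in>UNIV. D j g X \<bullet> (\<Sum>k\<in>UNIV. D k (D k (D j g)) X))"
    by (subst sum.swap) (simp add: inner_sum_right)
  then have "(\<Sum>k\<in>UNIV. \<Sum>j\<in>UNIV. D k (D j g) X \<bullet> D k (D j g) X) = 0"
    using second by (simp add: sum.distrib third add_eq_0_iff sum_negf)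
  then have z: "D k (D j g) X = 0" for k j
    by (simp add: sum_nonneg_eq_0_iff sum_nonneg)
  have "dir_deriv h (D j g) X = 0" for h j
    using linear_axis_expansion[OF has_derivative_linear[OF dDg[OF W(2)]]] by (simp add: Dd z)
  then have "(\<lambda>h. \<chi> a j. dir_deriv h (D j g) X $ a) = (\<lambda>h. 0)" by (simp add: fun_eq_iff vec_eq_iff)
  then show ?thesis using dF[OF W(2)] by simp
qed

lemma F_constant: "\<lbrakk>X \<in> B; Y \<in> B\<rbrakk> \<Longrightarrow> F X = F Y"
  by (rule body_constant[OF body continuous_on_F F_derivative_zero])

end

section \<open>Vanishing of the residual stress\<close>

lemma inner_symmetric_matrix:
  fixes M :: "real^'n^'n"
  assumes "transpose M = M" shows "x \<bullet> (M *v y) = (M *v x) \<bullet> y"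
  by (metis assms dot_lmul_matrix transpose_matrix_vector)

lemma farthest_point_in_frontier:
  fixes p :: "'a::euclidean_space"
  assumes "p \<in> B" and far: "\<And>y. y \<in> B \<Longrightarrow> norm y \<le> norm p"
  shows "p \<in> frontier B"
proof -
  have "p \<notin> interior B"
  proof
    assume "p \<in> interior B"
    then obtain r where r: "r > 0" "ball p r \<subseteq> B" by (meson mem_interior)
    obtain u :: 'a where u: "norm u = 1" using norm_Basis nonempty_Basis by blast
    \<comment> \<open>The sign is chosen so that the step does not decrease the norm to first order,
      also when \<open>p = 0\<close>.\<close>
    define w where "w = (if p \<bullet> u \<ge> 0 then u else - u)"
    have w: "norm w = 1" "p \<bullet> w \<ge> 0" by (auto simp: w_def u)
    have "p + (r/2) *\<^sub>R w \<in> B" using r w by (auto simp: dist_norm subset_iff)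
    then have "(p + (r/2) *\<^sub>R w) \<bullet> (p + (r/2) *\<^sub>R w) \<le> p \<bullet> p" using far by (simp add: norm_le[symmetric])
    moreover have "w \<bullet> w = 1" using w(1) by (simp add: norm_eq_1)
    ultimately have "r * (p \<bullet> w) + (r/2)\<^sup>2 \<le> 0"
      by (simp add: inner_add inner_commute power2_eq_square algebra_simps)
    moreover have "(r/2)\<^sup>2 > 0" "r * (p \<bullet> w) \<ge> 0" using r w by auto
    ultimately show False by linarith
  qed
  then show ?thesis using assms(1) closure_subset[of B] by (auto simp: frontier_def)
qed

text \<open>Two forms of the contraction of \<open>K ** transpose K\<close> with a Hessian: the
  right side comes out of the divergence identity, the left side lets the second-order condition act
  on each column.\<close>

lemma sum_hessian_columns:
  fixes K :: "real^'k^'n" and H :: "real^'n \<Rightarrow> real^'n"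
  assumes "linear H"
  shows "(\<Sum>k\<in>UNIV. column k K \<bullet> H (column k K)) = (\<Sum>j\<in>UNIV. (K ** transpose K *v H (axis j 1)) $ j)"
proof -
  have "column k K \<bullet> H (column k K) = (\<Sum>i\<in>UNIV. \<Sum>j\<in>UNIV. K $ j $ k * K $ i $ k * H (axis j 1) $ i)" for k
  proof -
    have "H (column k K) = (\<Sum>j\<in>UNIV. K $ j $ k *\<^sub>R H (axis j 1))"
      by (subst linear_axis_expansion[OF assms]) (simp add: column_def)
    then show ?thesis
      by (simp add: inner_vec_def column_def sum_distrib_left mult_ac)
  qed
  then have "(\<Sum>k\<in>UNIV. column k K \<bullet> H (column k K))
      = (\<Sum>k\<in>UNIV. \<Sum>i\<in>UNIV. \<Sum>j\<in>UNIV. K $ j $ k * K $ i $ k * H (axis j 1) $ i)" by simp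
  also have "\<dots> = (\<Sum>i\<in>UNIV. \<Sum>k\<in>UNIV. \<Sum>j\<in>UNIV. K $ j $ k * K $ i $ k * H (axis j 1) $ i)"
    by (rule sum.swap)
  also have "\<dots> = (\<Sum>i\<in>UNIV. \<Sum>j\<in>UNIV. \<Sum>k\<in>UNIV. K $ j $ k * K $ i $ k * H (axis j 1) $ i)"
    by (intro sum.cong refl sum.swap)
  also have "\<dots> = (\<Sum>j\<in>UNIV. \<Sum>i\<in>UNIV. \<Sum>k\<in>UNIV. K $ j $ k * K $ i $ k * H (axis j 1) $ i)"
    by (rule sum.swap)
  also have "\<dots> = (\<Sum>j\<in>UNIV. (K ** transpose K *v H (axis j 1)) $ j)"
    by (simp add: matrix_vector_mult_def matrix_matrix_mult_def transpose_def sum_distrib_right)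
  finally show ?thesis .
qed

context universal
begin

lemma residual: "residual_stress B S"
  using universal by (simp add: universal_pair_def)

lemma S_symmetric: "X \<in> B \<Longrightarrow> transpose (S X) = S X"
  using residual by (simp add: residual_stress_def)

lemma s_symmetric: "X \<in> B \<Longrightarrow> transpose (s X) = s X"
  by (simp add: s_def matrix_transpose_mul S_symmetric matrix_mul_assoc)

lemma trace_s2_constant:
  assumes "X \<in> B" "Y \<in> B" shows "trace (s X ** s X) = trace (s Y ** s Y)"
proof (rule body_constant[OF body _ _ assms])
  show "continuous_on B (\<lambda>X. trace (s X ** s X))"
    using trace_s2_derivative_zero has_derivative_continuous continuous_on_eq_continuous_within by blast
  fix Z assume Z: "Z \<in> interior B"
  then have "Z \<in> B" using interior_subset by blast
  from trace_s2_derivative_zero[OF this] show "((\<lambda>X. trace (s X ** s X)) has_derivative (\<lambda>h. 0)) (at Z)"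
    by (simp add: at_within_interior[OF Z])
qed

lemma s_zero_at_farthest_point:
  assumes p: "p \<in> B" and far: "\<And>y. y \<in> B \<Longrightarrow> norm y \<le> norm p"
  shows "s p = 0"
proof -
  have pf: "p \<in> frontier B" using farthest_point_in_frontier p far by blast
  obtain V \<rho> where chart: "boundary_chart B V \<rho>" and pV: "p \<in> V"
    using body_boundary_chart[OF body pf] by metis
  interpret boundary_chart B V \<rho> by (rule chart)
  define g where "g = gradient \<rho> p"
  obtain H where H: "(gradient \<rho> has_derivative H) (at p)" using has_derivative_gradient[OF pV] by blast
  have "smooth_on B S" using residual by (simp add: residual_stress_def)
  then obtain S' where S': "(S has_derivative S') (at p within B)"
    using smooth_on_has_derivative p by metis
  define A where "A = F p"
  define C where "C = transpose A ** A"
  \<comment> \<open>With \<open>F\<close> constant only \<open>S\<close> is left to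
    differentiate.\<close>
  have FA: "F Y = A" if "Y \<in> B" for Y using F_constant[OF that p] by (simp add: A_def)
  have symS: "transpose (S p) = S p" by (rule S_symmetric[OF p])
  have symC: "transpose C = C" by (simp add: C_def matrix_transpose_mul)
  have symS': "transpose (S' h) = S' h" for h
  proof -
    have "(S has_derivative (\<lambda>h. transpose (S' h))) (at p within B)"
      by (rule has_derivative_transform[OF p _ has_derivative_transpose[OF S']]) (simp add: S_symmetric)
    from derivative_unique[OF p this S'] show ?thesis by (rule fun_cong)
  qed
  note sym = inner_symmetric_matrix[OF symS] inner_symmetric_matrix[OF symC] inner_symmetric_matrix[OF symS']
  have traction: "S Y *v gradient \<rho> Y = 0" if Y: "Y \<in> V" "Y \<in> frontier B" for Y
  proof -
    have "S Y *v (gradient \<rho> Y /\<^sub>R norm (gradient \<rho> Y)) = 0"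
      using residual normal[OF Y] Y(2) unfolding residual_stress_def by blast
    then show ?thesis using gradient_nonzero[OF Y(1)] by (simp add: matrix_vector_mult_scaleR)
  qed
  have Sg: "S p *v g = 0" using traction[OF pV pf] by (simp add: g_def)

  define T' where "T' h = S p ** C ** S' h + S' h ** C ** S p" for h
  have dT: "((\<lambda>Y. S Y ** C ** S Y) has_derivative T') (at p within B)"
    unfolding T'_def[abs_def]
    by (intro has_derivative_matrix_mult
        bounded_linear.has_derivative[OF bounded_bilinear.bounded_linear_left[OF bounded_bilinear_matrix_matrix_mult]] S')
  have "((\<lambda>Y. A ** (S Y ** C ** S Y) ** transpose A) has_derivative (\<lambda>h. A ** T' h ** transpose A)) (at p within B)"
    by (intro bounded_linear.has_derivative[OF bounded_bilinear.bounded_linear_left[OF bounded_bilinear_matrix_matrix_mult]]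
        bounded_linear.has_derivative[OF bounded_bilinear.bounded_linear_right[OF bounded_bilinear_matrix_matrix_mult]] dT)
  then have "((\<lambda>Y. s Y ** s Y) has_derivative (\<lambda>h. A ** T' h ** transpose A)) (at p within B)"
    by (rule has_derivative_transform[OF p, rotated]) (simp add: s_def FA C_def matrix_mul_assoc)
  from divergence_s2[OF p this]
  have "(\<Sum>j\<in>UNIV. (A ** T' (Fi p *v axis j 1) ** transpose A) $ a $ j) = 0" for a .
  moreover have "linear (\<lambda>h. A ** T' h)"
    using linear_compose[OF has_derivative_linear[OF dT]
        bounded_linear.linear[OF bounded_bilinear.bounded_linear_right[OF bounded_bilinear_matrix_matrix_mult]], of A]
    by (simp add: o_def)
  ultimately have AT: "(\<Sum>j\<in>UNIV. (A ** T' (axis j 1)) $ a $ j) = 0" for a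
    using sum_divergence_change_of_variables[of "\<lambda>h. A ** T' h" "Fi p" A a] Fi_F(1)[OF p]
    by (simp add: A_def)
  \<comment> \<open>\<open>d\<close> is the divergence of \<open>S ** C ** S\<close>; the constant
    invertible factor \<open>A\<close> on its left is cancelled.\<close>
  define d where "d = (\<Sum>j\<in>UNIV. T' (axis j 1) *v axis j 1)"
  have "(A *v d) $ a = 0" for a
    using AT[of a] unfolding d_def
    by (simp add: linear_sum[OF matrix_vector_mul_linear] matrix_vector_mul_assoc)
       (simp add: matrix_vector_mult_basis column_def)
  then have "A *v d = 0" by (simp add: vec_eq_iff)
  then have "d = 0" using Fi_F_vec(1)[OF p, of d] by (simp add: A_def)

  \<comment> \<open>Derivative of \<open>S \<nabla>\<rho>\<close>, which vanishes along the
    boundary; only its normal part can survive.\<close>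
  define z' where "z' h = S p *v H h + S' h *v g" for h
  have dz: "((\<lambda>Y. S Y *v gradient \<rho> Y) has_derivative z') (at p within B)"
    using bounded_bilinear.FDERIV[OF bounded_bilinear_matrix_vector_mult S' has_derivative_at_withinI[OF H]]
    by (simp add: z'_def[abs_def] g_def)
  have linz: "linear z'" by (rule has_derivative_linear[OF dz])
  have gg: "g \<bullet> g > 0" using gradient_nonzero[OF pV] by (simp add: g_def)
  have z'_normal: "z' h = (h \<bullet> g / (g \<bullet> g)) *\<^sub>R z' g" for h
  proof -
    have "z' (h - (h \<bullet> g / (g \<bullet> g)) *\<^sub>R g) = 0"
      by (rule tangential_derivative_zero[OF pV pf _ dz open_V pV traction])
         (use gg in \<open>simp add: inner_diff_left g_def[symmetric]\<close>)
    then show ?thesis by (simp add: linear_diff[OF linz] linear_scale[OF linz])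
  qed
  \<comment> \<open>Contracting with \<open>S p ** C\<close> puts the surviving normal derivative
    against \<open>S p *v g\<close>, which is zero.\<close>
  have "(\<Sum>j\<in>UNIV. axis j 1 \<bullet> (S p *v (C *v z' (axis j 1)))) = (\<Sum>j\<in>UNIV. (g $ j / (g \<bullet> g)) * (axis j 1 \<bullet> (S p *v (C *v z' g))))"
    by (intro sum.cong refl, subst z'_normal) (simp add: matrix_vector_mult_scaleR inner_axis')
  also have "\<dots> = (g \<bullet> (S p *v (C *v z' g))) / (g \<bullet> g)"
    by (simp add: inner_axis' inner_vec_def[of g "S p *v _"] sum_divide_distrib)
  also have "\<dots> = 0" by (simp add: sym(1) Sg)
  finally have tr0: "(\<Sum>j\<in>UNIV. axis j 1 \<bullet> (S p *v (C *v z' (axis j 1)))) = 0" .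
  \<comment> \<open>By the product rule \<open>T'\<close> has two parts. Paired with
    \<open>g\<close>, the part beginning with \<open>S p\<close> vanishes and the other gives this
    sum.\<close>
  have "(\<Sum>j\<in>UNIV. axis j 1 \<bullet> (S p *v (C *v (S' (axis j 1) *v g)))) = g \<bullet> d"
  proof -
    have "axis j 1 \<bullet> (S p *v (C *v (S' h *v g))) = g \<bullet> (T' h *v axis j 1)" for j h
    proof -
      have "axis j 1 \<bullet> (S p *v (C *v (S' h *v g))) = g \<bullet> (S' h *v (C *v (S p *v axis j 1)))"
        by (subst inner_commute[of g]) (simp only: sym)
      moreover have "g \<bullet> (S p *v (C *v (S' h *v axis j 1))) = 0" by (simp add: sym(1) Sg)
      ultimately show ?thesis
        by (simp add: T'_def matrix_vector_mult_add_rdistrib inner_add_right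
            flip: matrix_vector_mul_assoc)
    qed
    then show ?thesis by (simp add: d_def inner_sum_right)
  qed
  then have hess0: "(\<Sum>j\<in>UNIV. axis j 1 \<bullet> (S p *v (C *v (S p *v H (axis j 1))))) = 0"
    using tr0 \<open>d = 0\<close>
    by (simp add: z'_def matrix_vector_right_distrib inner_add_right sum.distrib)

  \<comment> \<open>A factor of \<open>S ** C ** S\<close> at \<open>p\<close>: its columns lie in
    the range of \<open>S p\<close>, hence are tangent to the boundary, and
    \<open>s p = A ** K\<close>.\<close>
  define K where "K = S p ** transpose A"
  have KK: "K ** transpose K = S p ** C ** S p"
    by (simp add: K_def C_def matrix_transpose_mul symS matrix_mul_assoc)
  have hess: "(\<Sum>k\<in>UNIV. column k K \<bullet> H (column k K)) = 0"
    using hess0 unfolding sum_hessian_columns[OF has_derivative_linear[OF H]] KK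
    by (simp add: inner_axis' flip: matrix_vector_mul_assoc)
  obtain c where c: "c \<ge> 0" "p = c *\<^sub>R gradient \<rho> p" using farthest_point_gradient[OF pV pf far] by blast
  have tang: "column k K \<bullet> gradient \<rho> p = 0" for k
  proof -
    have "column k K = S p *v (transpose A *v axis k 1)"
      by (simp only: K_def matrix_vector_mult_basis[symmetric] matrix_vector_mul_assoc)
    then show ?thesis by (simp add: sym(1)[symmetric] Sg[unfolded g_def])
  qed
  have "(\<Sum>k\<in>UNIV. column k K \<bullet> column k K) \<le> (\<Sum>k\<in>UNIV. c * (column k K \<bullet> H (column k K)))"
    by (intro sum_mono farthest_point_hessian[OF pV pf far c H tang])
  also have "\<dots> = 0" by (simp add: sum_distrib_left[symmetric] hess)
  finally have "(\<Sum>k\<in>UNIV. column k K \<bullet> column k K) = 0" by (simp add: antisym sum_nonneg)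
  then have "column k K = 0" for k by (simp add: sum_nonneg_eq_0_iff)
  then have "K = 0" by (simp add: column_def vec_eq_iff)
  moreover have "s p = A ** K" by (simp add: s_def A_def K_def matrix_mul_assoc)
  ultimately show ?thesis by simp
qed

text \<open>For symmetric \<open>s X\<close> the fifth invariant is the squared Frobenius norm, so
  its vanishing forces \<open>s X = 0\<close>, and invertibility of \<open>F X\<close> carries this
  over to \<open>S X\<close>. Compactness provides the farthest point.\<close>

lemma S_zero:
  assumes X: "X \<in> B" shows "S X = 0"
proof -
  have "compact B" "B \<noteq> {}" using body by (auto simp: body_def compact_eq_bounded_closed)
  then obtain p where p: "p \<in> B" "\<And>y. y \<in> B \<Longrightarrow> norm y \<le> norm p"
    using distance_attains_sup[of B 0] by auto
  have "trace (s X ** s X) = trace (s p ** s p)" by (rule trace_s2_constant[OF X p(1)])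
  also have "\<dots> = 0" by (simp add: s_zero_at_farthest_point[OF p] trace_def)
  finally have "trace (s X ** transpose (s X)) = 0" by (simp add: s_symmetric[OF X])
  then have "(\<Sum>i\<in>UNIV. \<Sum>j\<in>UNIV. s X $ i $ j * s X $ i $ j) = 0"
    by (simp add: trace_def matrix_matrix_mult_def transpose_def)
  then have "s X = 0" by (simp add: sum_nonneg_eq_0_iff sum_nonneg vec_eq_iff)
  have "S X = (Fi X ** F X) ** S X ** transpose (Fi X ** F X)" by (simp add: Fi_F[OF X])
  also have "\<dots> = Fi X ** s X ** transpose (Fi X)" by (simp add: s_def matrix_transpose_mul matrix_mul_assoc)
  finally show ?thesis using \<open>s X = 0\<close> by simp
qed

end

text \<open>Constant \<open>F\<close> and zero residual stress make every argument of the response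
  functions constant, so the stress is constant whatever the response functions are.\<close>

lemma homogeneous_universal:
  assumes "homogeneous_deformation B \<phi>"
  shows "universal_pair B \<phi> (\<lambda>_. 0)"
  unfolding universal_pair_def
proof (intro conjI allI impI ballI)
  show "deformation B \<phi>" using assms by (simp add: homogeneous_deformation_def)
  have "((\<lambda>_. 0 :: real^3^3) has_derivative (\<lambda>_. 0)) (at X within B)" for X by simp
  then have "has_divergence (\<lambda>_. 0) 0 X B" for X
    unfolding has_divergence_def by (intro exI[of _ "\<lambda>_. 0"]) (simp add: vec_eq_iff)
  then show "residual_stress B (\<lambda>_. 0)"
    by (simp add: residual_stress_def smooth_on_const transpose_def vec_eq_iff)
  fix \<alpha> x assume x: "x \<in> \<phi> ` B"
  obtain A where A: "\<And>X. X \<in> B \<Longrightarrow> deformation_gradient B \<phi> X = A"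
    using assms by (auto simp: homogeneous_deformation_def)
  have "cauchy_stress \<alpha> B \<phi> (\<lambda>_. 0) y = stress_response \<alpha> (A ** transpose A) 0" if "y \<in> \<phi> ` B" for y
    using A[OF inv_into_into[OF that]]
    by (simp add: cauchy_stress_def b_field_def pushed_residual_stress_def Let_def)
  then have "(cauchy_stress \<alpha> B \<phi> (\<lambda>_. 0) has_derivative (\<lambda>_. 0)) (at x within \<phi> ` B)"
    by (intro has_derivative_transform[OF x _ has_derivative_const]) auto
  then show "has_divergence (cauchy_stress \<alpha> B \<phi> (\<lambda>_. 0)) 0 x (\<phi> ` B)"
    unfolding has_divergence_def by (intro exI[of _ "\<lambda>_. 0"]) (simp add: vec_eq_iff)
qed

theorem proposition4p1:
  fixes B :: "(real^3) set"
  assumes "body B"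
  shows "(\<forall>\<phi>. deformation B \<phi> \<longrightarrow>
             (universal_deformation B \<phi> \<longleftrightarrow> homogeneous_deformation B \<phi>)) \<and>
         (\<forall>\<phi> S. universal_pair B \<phi> S \<longrightarrow> (\<forall>X\<in>B. S X = 0))"
proof -
  have loc: "universal B \<phi> S" if "universal_pair B \<phi> S" for \<phi> S
    using assms that by unfold_locales (auto simp: universal_pair_def)
  have "homogeneous_deformation B \<phi>" if \<phi>: "universal_pair B \<phi> S" for \<phi> S
  proof -
    interpret universal B \<phi> S by (rule loc[OF \<phi>])
    obtain X0 where "X0 \<in> B" using assms by (auto simp: body_def)
    then show ?thesis
      using deformation F_constant unfolding homogeneous_deformation_def by blast
  qed
  then show ?thesis
    using homogeneous_universal universal.S_zero[OF loc]
    unfolding universal_deformation_def by blast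
qed

end
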